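(* Let $\Bbbk$ be an algebraically closed field of characteristic $3$, let $G$ be a (simple) algebraic group of type $F_4$ over $\Bbbk$, and let $\mathfrak{g}=\mathrm{Lie}(G)$, with Chevalley basis elements $e_\alpha$ and $f_\alpha=e_{-\alpha}$ for positive roots $\alpha$, indexed by the coefficients of $\alpha$ with respect to the simple roots $\alpha_1,\alpha_2,\alpha_3,\alpha_4$. Let $$e:=e_{1000}+e_{0100}+e_{0001}+e_{0120},$$ which is a representative of the nilpotent orbit denoted $F_4(a_1)$, and let $f:=f_{1232}$. Let $L:=\langle e,f\rangle$ be the Lie subalgebra of $\mathfrak{g}$ generated by $e$ and $f$. Then $L$ is isomorphic, as a Lie algebra, to the restricted Ermolaev algebra $\mathrm{Er}(1;1)^{(1)}$, and $L$ is a maximal subalgebra of $\mathfrak{g}$.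
   Context: Root notation. Simple roots $\alpha_1,\alpha_2,\alpha_3,\alpha_4$ of the root system $\Phi$ of type $F_4$ are numbered as in Bourbaki (so $\alpha_1,\alpha_2$ are long, $\alpha_3,\alpha_4$ are short, the Dynkin diagram is the chain $\alpha_1-\alpha_2-\alpha_3-\alpha_4$, and the highest root is $2\alpha_1+3\alpha_2+4\alpha_3+2\alpha_4$). For a positive root $\alpha=a\alpha_1+b\alpha_2+c\alpha_3+d\alpha_4$ one writes $e_{abcd}=e_\alpha$ and $f_{abcd}=e_{-\alpha}$, where $\{e_\alpha:\alpha\in\Phi\}\cup\{h_{\alpha_i}: 1\le i\le 4\}$ is a Chevalley basis of $\mathfrak{g}$ (the reduction to $\Bbbk$ of a Chevalley basis of the complex simple Lie algebra of type $F_4$); $\dim\mathfrak{g}=52$ and $\mathfrak{g}$ is simple. The orbit $F_4(a_1)$ is the subregular nilpotent $G$-orbit in $\mathfrak{g}$, i.e. the unique nilpotent orbit of codimension $6$. A maximal subalgebra of $\mathfrak{g}$ is a proper Lie subalgebra $L\subsetneq\mathfrak{g}$ such that there is no Lie subalgebra $M$ with $L\subsetneq M\subsetneq\mathfrak{g}$. The restricted Ermolaev algebra. Let $\mathcal{O}(2;1)=\Bbbk[x_1,x_2]/(x_1^3,x_2^3)$ be the truncated polynomial algebra and let $W(2;1)=\mathrm{Der}(\mathcal{O}(2;1))=\{f_1\partial_1+f_2\partial_2: f_1,f_2\in\mathcal{O}(2;1)\}$ be its Lie algebra of derivations, with $\partial_i=\partial/\partial x_i$. Put $\mathrm{div}(f_1\partial_1+f_2\partial_2)=\partial_1(f_1)+\partial_2(f_2)$.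 Let $\mathcal{O}(2;1)_{(\mathrm{div})}$ denote the vector space $\mathcal{O}(2;1)$ with the $W(2;1)$-module structure $D\cdot f:=D(f)+\mathrm{div}(D)f$. The Lie algebra $\mathrm{Er}(1;1)$ is the vector space $W(2;1)\oplus\mathcal{O}(2;1)_{(\mathrm{div})}$ with bracket extending that of $W(2;1)$, with $[D,f]:=D\cdot f$ for $D\in W(2;1)$, $f\in\mathcal{O}(2;1)_{(\mathrm{div})}$, and $$[f,g]:=(f\partial_2(g)-g\partial_2(f))\partial_1+(g\partial_1(f)-f\partial_1(g))\partial_2\in W(2;1)$$ for $f,g\in\mathcal{O}(2;1)_{(\mathrm{div})}$. Its derived subalgebra is $\mathrm{Er}(1;1)^{(1)}=W(2;1)\oplus\mathcal{O}'(2;1)_{(\mathrm{div})}$, where $\mathcal{O}'(2;1)_{(\mathrm{div})}$ is the codimension-one submodule of $\mathcal{O}(2;1)_{(\mathrm{div})}$ spanned by the monomials $x_1^ax_2^b$ with $0\le a,b\le 2$ and $(a,b)\neq(2,2)$. This is a simple Lie algebra of dimension $26$, called the restricted Ermolaev algebra. *)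

theory Defs
  imports
    Complex_Main
    "HOL-Computational_Algebra.Polynomial"
    "HOL-Library.Product_Plus"
begin

section \<open>Lie algebras\<close>

locale lie_algebra = vector_space scale
  for scale :: "'k::field \<Rightarrow> 'v::ab_group_add \<Rightarrow> 'v" (infixr \<open>*s\<close> 75) +
  fixes bracket :: "'v \<Rightarrow> 'v \<Rightarrow> 'v"
  assumes linear_left: "Vector_Spaces.linear scale scale (\<lambda>x. bracket x y)"
    and linear_right: "Vector_Spaces.linear scale scale (bracket x)"
    and alternating: "bracket x x = 0"
    and jacobi: "bracket x (bracket y z) + bracket y (bracket z x) + bracket z (bracket x y) = 0"
begin

definition subalgebra :: "'v set \<Rightarrow> bool" where
  "subalgebra S \<longleftrightarrow> subspace S \<and> (\<forall>x\<in>S. \<forall>y\<in>S. bracket x y \<in> S)"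

definition generated :: "'v set \<Rightarrow> 'v set" where
  "generated X = subalgebra hull X"

definition derived :: "'v set" where
  "derived = span {bracket x y | x y. True}"

definition maximal_subalgebra :: "'v set \<Rightarrow> bool" where
  "maximal_subalgebra L \<longleftrightarrow>
     subalgebra L \<and> L \<subset> UNIV \<and> (\<nexists>M. subalgebra M \<and> L \<subset> M \<and> M \<subset> UNIV)"

end

text \<open>Isomorphism between subalgebras \<open>S\<close> and \<open>T\<close> of two (possibly different) Lie algebras.\<close>

definition lie_isomorphic ::
  "('k \<Rightarrow> 'v::ab_group_add \<Rightarrow> 'v) \<Rightarrow> ('v \<Rightarrow> 'v \<Rightarrow> 'v) \<Rightarrow> 'v set \<Rightarrow>
   ('k \<Rightarrow> 'w::ab_group_add \<Rightarrow> 'w) \<Rightarrow> ('w \<Rightarrow> 'w \<Rightarrow> 'w) \<Rightarrow> 'w set \<Rightarrow> bool" where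
  "lie_isomorphic scale1 bracket1 S scale2 bracket2 T \<longleftrightarrow>
     (\<exists>\<phi>. bij_betw \<phi> S T \<and>
          (\<forall>x\<in>S. \<forall>y\<in>S. \<phi> (x + y) = \<phi> x + \<phi> y) \<and>
          (\<forall>c. \<forall>x\<in>S. \<phi> (scale1 c x) = scale2 c (\<phi> x)) \<and>
          (\<forall>x\<in>S. \<forall>y\<in>S. \<phi> (bracket1 x y) = bracket2 (\<phi> x) (\<phi> y)))"


section \<open>Chevalley bases of type F4\<close>

text \<open>\<open>(a, b, c, d)\<close> stands for \<open>a\<alpha>\<^sub>1 + b\<alpha>\<^sub>2 + c\<alpha>\<^sub>3 + d\<alpha>\<^sub>4\<close> in the root lattice.\<close>

type_synonym root = "int \<times> int \<times> int \<times> int"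

definition simple_root :: "nat \<Rightarrow> root" where
  "simple_root i = [(1,0,0,0), (0,1,0,0), (0,0,1,0), (0,0,0,1)] ! (i - 1)"

fun root_coeff :: "root \<Rightarrow> nat \<Rightarrow> int" where
  "root_coeff (a, b, c, d) i = [a, b, c, d] ! (i - 1)"

fun root_mult :: "int \<Rightarrow> root \<Rightarrow> root" where
  "root_mult m (a, b, c, d) = (m * a, m * b, m * c, m * d)"

text \<open>
  The Weyl-invariant form, scaled so that long roots have squared length 4 and short roots 2.
  Its Gram matrix encodes the diagram \<open>\<alpha>\<^sub>1 - \<alpha>\<^sub>2 => \<alpha>\<^sub>3 - \<alpha>\<^sub>4\<close> with \<open>\<alpha>\<^sub>1, \<alpha>\<^sub>2\<close> long.
\<close>

fun root_form :: "root \<Rightarrow> root \<Rightarrow> int" where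
  "root_form (a, b, c, d) (a', b', c', d') =
     4 * a * a' + 4 * b * b' + 2 * c * c' + 2 * d * d'
     - 2 * (a * b' + b * a') - 2 * (b * c' + c * b') - (c * d' + d * c')"

text \<open>
  As in Humphreys, Section 12.1, the root system consists of all lattice vectors having the length
  of a short or of a long simple root: 24 short and 24 long roots.
\<close>

definition roots :: "root set" where
  "roots = {\<alpha>. root_form \<alpha> \<alpha> \<in> {2, 4}}"

text \<open>The Cartan integer \<open>\<langle>\<beta>, \<alpha>\<^sup>\<or>\<rangle> = 2(\<beta>,\<alpha>)/(\<alpha>,\<alpha>)\<close>; the division is exact when \<open>\<alpha>\<close> is a root.\<close>

definition cartan_integer :: "root \<Rightarrow> root \<Rightarrow> int" where
  "cartan_integer \<beta> \<alpha> = 2 * root_form \<beta> \<alpha> div root_form \<alpha> \<alpha>"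

text \<open>
  The coefficient of \<open>\<alpha>\<^sub>i\<^sup>\<or>\<close> in the coroot \<open>\<alpha>\<^sup>\<or> = 2\<alpha>/(\<alpha>,\<alpha>)\<close>: since \<open>\<alpha>\<^sub>i = (\<alpha>\<^sub>i,\<alpha>\<^sub>i)/2 \<cdot> \<alpha>\<^sub>i\<^sup>\<or>\<close>, it is
  \<open>m\<^sub>i(\<alpha>\<^sub>i,\<alpha>\<^sub>i)/(\<alpha>,\<alpha>)\<close> for \<open>\<alpha> = \<Sum>\<^sub>i m\<^sub>i\<alpha>\<^sub>i\<close>; again the division is exact.
\<close>

definition coroot_coeff :: "root \<Rightarrow> nat \<Rightarrow> int" where
  "coroot_coeff \<alpha> i =
     root_coeff \<alpha> i * root_form (simple_root i) (simple_root i) div root_form \<alpha> \<alpha>"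

text \<open>The greatest \<open>r\<close> such that \<open>\<beta> - r\<alpha>\<close> is a root.\<close>

definition root_string_down :: "root \<Rightarrow> root \<Rightarrow> nat" where
  "root_string_down \<alpha> \<beta> = Max {r. \<beta> - root_mult (int r) \<alpha> \<in> roots}"

text \<open>
  \<open>e \<alpha>\<close> (\<open>\<alpha>\<close> a root) and \<open>h i\<close> (\<open>1 \<le> i \<le> 4\<close>) form a basis of the Lie algebra that multiplies by
  Chevalley's rules, with integral structure constants \<open>N\<close>.  Over the complex numbers this says that
  the algebra is the simple Lie algebra of type F4 and that \<open>e\<close>, \<open>h\<close> is a Chevalley basis of it.
  Over another field, where the signs in \<open>N\<close> are not determined by the bracket alone, the locale
  is meant to be used with an \<open>N\<close> that comes from a complex Chevalley basis: the algebra is then the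
  reduction (base change of the Chevalley lattice) of the complex one.
\<close>

locale F4_chevalley_basis = lie_algebra scale bracket
  for scale :: "'k::field \<Rightarrow> 'v::ab_group_add \<Rightarrow> 'v" (infixr \<open>*s\<close> 75)
    and bracket :: "'v \<Rightarrow> 'v \<Rightarrow> 'v" +
  fixes e :: "root \<Rightarrow> 'v"
    and h :: "nat \<Rightarrow> 'v"
    and N :: "root \<Rightarrow> root \<Rightarrow> int"
  assumes inj_e: "inj_on e roots"
    and inj_h: "inj_on h {1..4}"
    and disjoint: "e ` roots \<inter> h ` {1..4} = {}"
    and independent: "independent (e ` roots \<union> h ` {1..4})"
    and spanning: "span (e ` roots \<union> h ` {1..4}) = UNIV"
    and h_h: "\<lbrakk>i \<in> {1..4}; j \<in> {1..4}\<rbrakk> \<Longrightarrow> bracket (h i) (h j) = 0"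
    and h_e: "\<lbrakk>i \<in> {1..4}; \<alpha> \<in> roots\<rbrakk> \<Longrightarrow>
      bracket (h i) (e \<alpha>) = of_int (cartan_integer \<alpha> (simple_root i)) *s e \<alpha>"
    and e_opposite: "\<alpha> \<in> roots \<Longrightarrow>
      bracket (e \<alpha>) (e (- \<alpha>)) = (\<Sum>i\<in>{1..4}. of_int (coroot_coeff \<alpha> i) *s h i)"
    and e_e: "\<lbrakk>\<alpha> \<in> roots; \<beta> \<in> roots; \<alpha> + \<beta> \<in> roots\<rbrakk> \<Longrightarrow>
      bracket (e \<alpha>) (e \<beta>) = of_int (N \<alpha> \<beta>) *s e (\<alpha> + \<beta>)"
    and e_e_0: "\<lbrakk>\<alpha> \<in> roots; \<beta> \<in> roots; \<alpha> + \<beta> \<notin> roots; \<alpha> + \<beta> \<noteq> 0\<rbrakk> \<Longrightarrow>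
      bracket (e \<alpha>) (e \<beta>) = 0"
    and N_abs: "\<lbrakk>\<alpha> \<in> roots; \<beta> \<in> roots; \<alpha> + \<beta> \<in> roots\<rbrakk> \<Longrightarrow>
      \<bar>N \<alpha> \<beta>\<bar> = int (root_string_down \<alpha> \<beta>) + 1"
    and N_neg: "\<lbrakk>\<alpha> \<in> roots; \<beta> \<in> roots; \<alpha> + \<beta> \<in> roots\<rbrakk> \<Longrightarrow>
      N (- \<alpha>) (- \<beta>) = - N \<alpha> \<beta>"


section \<open>The truncated polynomial algebra in two variables of height one\<close>

text \<open>
  In characteristic 3, this is \<open>O(2;1) = k[x\<^sub>1,x\<^sub>2]/(x\<^sub>1\<^sup>3,x\<^sub>2\<^sup>3)\<close>: residue classes are represented
  by the coefficients of \<open>x\<^sub>1\<^sup>i x\<^sub>2\<^sup>j\<close> with \<open>i, j < 3\<close>.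
\<close>

typedef (overloaded) 'a trunc_poly =
  "{c :: nat \<Rightarrow> nat \<Rightarrow> 'a::zero. \<forall>i j. 3 \<le> i \<or> 3 \<le> j \<longrightarrow> c i j = 0}"
  morphisms tcoeff Trunc
  by (rule exI[of _ "\<lambda>_ _. 0"]) simp

setup_lifting type_definition_trunc_poly

lemma trunc_poly_eqI:
  assumes "\<And>i j. i < 3 \<Longrightarrow> j < 3 \<Longrightarrow> tcoeff f i j = tcoeff g i j"
  shows "f = g"
proof -
  have "tcoeff f i j = tcoeff g i j" for i j
    using assms[of i j] tcoeff[of f] tcoeff[of g] by (cases "i < 3 \<and> j < 3") auto
  then show ?thesis
    by (metis ext tcoeff_inject)
qed

lift_definition truncate :: "'a::zero poly poly \<Rightarrow> 'a trunc_poly" is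
  "\<lambda>p i j. if i < 3 \<and> j < 3 then coeff (coeff p j) i else 0"
  by auto

lemma truncate_surj: "\<exists>p. f = truncate p" for f :: "'a::comm_ring_1 trunc_poly"
proof
  let ?p = "Poly (map (\<lambda>j. Poly (map (\<lambda>i. tcoeff f i j) [0..<3])) [0..<3])"
  show "f = truncate ?p"
    by (rule trunc_poly_eqI) (simp add: truncate.rep_eq nth_default_nth del: upt.simps)
qed

instantiation trunc_poly :: (comm_ring_1) comm_ring_1
begin

lift_definition zero_trunc_poly :: "'a trunc_poly" is "\<lambda>_ _. 0" by simp
lift_definition one_trunc_poly :: "'a trunc_poly" is "\<lambda>i j. if i = 0 \<and> j = 0 then 1 else 0" by auto
lift_definition plus_trunc_poly :: "'a trunc_poly \<Rightarrow> 'a trunc_poly \<Rightarrow> 'a trunc_poly"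
  is "\<lambda>f g i j. f i j + g i j" by auto
lift_definition minus_trunc_poly :: "'a trunc_poly \<Rightarrow> 'a trunc_poly \<Rightarrow> 'a trunc_poly"
  is "\<lambda>f g i j. f i j - g i j" by auto
lift_definition uminus_trunc_poly :: "'a trunc_poly \<Rightarrow> 'a trunc_poly"
  is "\<lambda>f i j. - f i j" by auto
lift_definition times_trunc_poly :: "'a trunc_poly \<Rightarrow> 'a trunc_poly \<Rightarrow> 'a trunc_poly"
  is "\<lambda>f g i j. if i < 3 \<and> j < 3 then \<Sum>k\<le>i. \<Sum>l\<le>j. f k l * g (i - k) (j - l) else 0" by auto

lemma truncate_0: "truncate 0 = (0 :: 'a trunc_poly)"
  by (rule trunc_poly_eqI) (simp add: truncate.rep_eq zero_trunc_poly.rep_eq)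

lemma truncate_1: "truncate 1 = (1 :: 'a trunc_poly)"
  by (rule trunc_poly_eqI) (simp add: truncate.rep_eq one_trunc_poly.rep_eq coeff_1)

lemma truncate_add: "truncate (p + q) = truncate p + (truncate q :: 'a trunc_poly)"
  by (rule trunc_poly_eqI) (simp add: truncate.rep_eq plus_trunc_poly.rep_eq)

lemma truncate_minus: "truncate (- p) = - (truncate p :: 'a trunc_poly)"
  by (rule trunc_poly_eqI) (simp add: truncate.rep_eq uminus_trunc_poly.rep_eq)

lemma truncate_diff: "truncate (p - q) = truncate p - (truncate q :: 'a trunc_poly)"
  by (rule trunc_poly_eqI) (simp add: truncate.rep_eq minus_trunc_poly.rep_eq)

lemma truncate_mult: "truncate (p * q) = truncate p * (truncate q :: 'a trunc_poly)"
proof (rule trunc_poly_eqI)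
  fix i j :: nat
  assume ij: "i < 3" "j < 3"
  have "coeff (coeff (p * q) j) i
      = (\<Sum>l\<le>j. \<Sum>k\<le>i. coeff (coeff p l) k * coeff (coeff q (j - l)) (i - k))"
    by (simp add: coeff_mult coeff_sum)
  also have "\<dots> = (\<Sum>k\<le>i. \<Sum>l\<le>j. coeff (coeff p l) k * coeff (coeff q (j - l)) (i - k))"
    by (rule sum.swap)
  also have "\<dots> = tcoeff (truncate p * truncate q) i j"
    using ij by (auto simp: truncate.rep_eq times_trunc_poly.rep_eq intro!: sum.cong)
  finally show "tcoeff (truncate (p * q)) i j = tcoeff (truncate p * truncate q) i j"
    using ij by (simp add: truncate.rep_eq)
qed

instance
proof
  fix f g k :: "'a trunc_poly"
  obtain p q r where f: "f = truncate p" and g: "g = truncate q" and k: "k = truncate r"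
    using truncate_surj by metis
  note simps = f g k truncate_0[symmetric] truncate_1[symmetric] truncate_add[symmetric]
    truncate_minus[symmetric] truncate_diff[symmetric] truncate_mult[symmetric]
  show "f * g * k = f * (g * k)" by (simp add: simps mult.assoc)
  show "f * g = g * f" by (simp add: simps mult.commute)
  show "1 * f = f" by (simp add: simps)
  show "f + g + k = f + (g + k)" by (simp add: simps add.assoc)
  show "f + g = g + f" by (simp add: simps add.commute)
  show "0 + f = f" by (simp add: simps)
  show "- f + f = 0" by (simp add: simps)
  show "f - g = f + - g" by (simp add: simps)
  show "(f + g) * k = f * k + g * k" by (simp add: simps distrib_right)
  show "(0::'a trunc_poly) \<noteq> 1"
    by (metis one_trunc_poly.rep_eq zero_trunc_poly.rep_eq zero_neq_one)
qed

end

lift_definition tscale :: "'a::comm_ring_1 \<Rightarrow> 'a trunc_poly \<Rightarrow> 'a trunc_poly"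
  is "\<lambda>c f i j. c * f i j" by auto

text \<open>The partial derivatives; they are derivations for the truncated product in characteristic 3.\<close>

lift_definition partial1 :: "'a::comm_ring_1 trunc_poly \<Rightarrow> 'a trunc_poly"
  is "\<lambda>f i j. of_nat (Suc i) * f (Suc i) j" by auto

lift_definition partial2 :: "'a::comm_ring_1 trunc_poly \<Rightarrow> 'a trunc_poly"
  is "\<lambda>f i j. of_nat (Suc j) * f i (Suc j)" by auto


section \<open>The Witt algebra and the Ermolaev algebra\<close>

text \<open>\<open>(f\<^sub>1, f\<^sub>2)\<close> stands for the derivation \<open>f\<^sub>1\<partial>\<^sub>1 + f\<^sub>2\<partial>\<^sub>2\<close> of \<open>O(2;1)\<close>.\<close>

type_synonym 'a witt = "'a trunc_poly \<times> 'a trunc_poly"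

fun witt_apply :: "'a::comm_ring_1 witt \<Rightarrow> 'a trunc_poly \<Rightarrow> 'a trunc_poly" where
  "witt_apply (f1, f2) g = f1 * partial1 g + f2 * partial2 g"

text \<open>The commutator of derivations, determined by its values on \<open>x\<^sub>1\<close> and \<open>x\<^sub>2\<close>.\<close>

fun witt_bracket :: "'a::comm_ring_1 witt \<Rightarrow> 'a witt \<Rightarrow> 'a witt" where
  "witt_bracket (f1, f2) (g1, g2) =
     (witt_apply (f1, f2) g1 - witt_apply (g1, g2) f1,
      witt_apply (f1, f2) g2 - witt_apply (g1, g2) f2)"

fun witt_div :: "'a::comm_ring_1 witt \<Rightarrow> 'a trunc_poly" where
  "witt_div (f1, f2) = partial1 f1 + partial2 f2"

definition div_act :: "'a::comm_ring_1 witt \<Rightarrow> 'a trunc_poly \<Rightarrow> 'a trunc_poly" where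
  "div_act D f = witt_apply D f + witt_div D * f"

type_synonym 'a ermolaev = "'a witt \<times> 'a trunc_poly"

fun er_scale :: "'a::comm_ring_1 \<Rightarrow> 'a ermolaev \<Rightarrow> 'a ermolaev" where
  "er_scale c ((f1, f2), f) = ((tscale c f1, tscale c f2), tscale c f)"

fun er_bracket :: "'a::comm_ring_1 ermolaev \<Rightarrow> 'a ermolaev \<Rightarrow> 'a ermolaev" where
  "er_bracket (D, f) (E, g) =
     (witt_bracket D E
        + (f * partial2 g - g * partial2 f, g * partial1 f - f * partial1 g),
      div_act D g - div_act E f)"

definition restricted_ermolaev :: "'a::field ermolaev set" where
  "restricted_ermolaev = lie_algebra.derived er_scale er_bracket"


section \<open>The Lie algebra laws for the Ermolaev algebra\<close>

lift_definition swap_vars :: "'a::comm_ring_1 trunc_poly \<Rightarrow> 'a trunc_poly"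
  is "\<lambda>f i j. f j i" by auto

lemma swap_vars_mult: "swap_vars (f * g) = swap_vars f * swap_vars g"
  by (rule trunc_poly_eqI) (auto simp: swap_vars.rep_eq times_trunc_poly.rep_eq intro: sum.swap)

lemma swap_vars_add: "swap_vars (f + g) = swap_vars f + swap_vars g"
  by (rule trunc_poly_eqI) (simp add: swap_vars.rep_eq plus_trunc_poly.rep_eq)

lemma partial1_swap: "partial1 f = swap_vars (partial2 (swap_vars f))"
  by (rule trunc_poly_eqI) (simp add: swap_vars.rep_eq partial1.rep_eq partial2.rep_eq)

lemma swap_swap: "swap_vars (swap_vars f) = f"
  by (rule trunc_poly_eqI) (simp add: swap_vars.rep_eq)

lemma partial_commute: "partial1 (partial2 f) = partial2 (partial1 f)"
  by (rule trunc_poly_eqI) (simp add: partial1.rep_eq partial2.rep_eq algebra_simps)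

lemma partial_add:
  "partial1 (f + g) = partial1 f + partial1 g"  "partial2 (f + g) = partial2 f + partial2 g"
  by (rule trunc_poly_eqI; simp add: partial1.rep_eq partial2.rep_eq plus_trunc_poly.rep_eq
      algebra_simps)+

lemma partial_diff:
  "partial1 (f - g) = partial1 f - partial1 g"  "partial2 (f - g) = partial2 f - partial2 g"
  by (rule trunc_poly_eqI; simp add: partial1.rep_eq partial2.rep_eq minus_trunc_poly.rep_eq
      algebra_simps)+

lemma partial_scale:
  "partial1 (tscale c f) = tscale c (partial1 f)"  "partial2 (tscale c f) = tscale c (partial2 f)"
  by (rule trunc_poly_eqI; simp add: partial1.rep_eq partial2.rep_eq tscale.rep_eq algebra_simps)+

lemma tscale_mult:
  "tscale c f * g = tscale c (f * g)"
  "f * tscale c g = tscale c (f * g)"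
  for f g :: "'a::comm_ring_1 trunc_poly"
proof -
  show *: "tscale c f * g = tscale c (f * g)" for f g :: "'a trunc_poly"
    by (rule trunc_poly_eqI) (simp add: tscale.rep_eq times_trunc_poly.rep_eq sum_distrib_left mult.assoc)
  show "f * tscale c g = tscale c (f * g)"
    using *[of g f] by (simp add: mult.commute)
qed

lemma tscale_simps:
  "tscale c (f + g) = tscale c f + tscale c g"
  "tscale c (f - g) = tscale c f - tscale c g"
  "tscale (c + d) f = tscale c f + tscale d f"
  "tscale c (tscale d f) = tscale (c * d) f"
  "tscale 1 f = f"
  by (rule trunc_poly_eqI; simp add: tscale.rep_eq plus_trunc_poly.rep_eq minus_trunc_poly.rep_eq
      algebra_simps)+

lemma of_nat_trunc: "of_nat n * f = tscale (of_nat n) (f :: 'a::comm_ring_1 trunc_poly)"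
proof (induction n)
  case 0
  show ?case by (rule trunc_poly_eqI) (simp add: tscale.rep_eq zero_trunc_poly.rep_eq)
next
  case (Suc n)
  then show ?case by (simp add: algebra_simps tscale_simps)
qed

context
  assumes char: "CHAR('a::field) = 3"
begin

lemma three: "(3 :: 'a) = 0"
  using of_nat_CHAR[where 'a='a] char by simp

lemma three_trunc: "3 = (0 :: 'a trunc_poly)"
proof -
  have "3 = tscale (3 :: 'a) 1"
    using of_nat_trunc[of 3 "1 :: 'a trunc_poly"] by simp
  also have "\<dots> = 0"
    by (rule trunc_poly_eqI) (simp add: three tscale.rep_eq zero_trunc_poly.rep_eq)
  finally show ?thesis .
qed

lemma partial2_truncate: "partial2 (truncate p) = truncate (pderiv p :: 'a poly poly)"
proof (rule trunc_poly_eqI)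
  fix i j :: nat assume ij: "i < 3" "j < 3"
  have *: "coeff (of_nat n * q) i = of_nat n * coeff q i" for n and q :: "'a poly"
    by (simp add: of_nat_poly)
  show "tcoeff (partial2 (truncate p)) i j = tcoeff (truncate (pderiv p)) i j"
  proof (cases "j = 2")
    case True
    have "coeff (of_nat (Suc j) * q) i = 0" for q :: "'a poly"
      unfolding * using True three by simp
    then show ?thesis using ij True by (simp add: partial2.rep_eq truncate.rep_eq coeff_pderiv)
  next
    case False
    then show ?thesis using ij *[of "Suc j" "coeff p (Suc j)"]
      by (simp add: partial2.rep_eq truncate.rep_eq coeff_pderiv del: of_nat_Suc)
  qed
qed

lemma partial2_mult: "partial2 (f * g) = f * partial2 g + g * partial2 (f :: 'a trunc_poly)"
proof -
  obtain p q where "f = truncate p" "g = truncate q" using truncate_surj by metis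
  then show ?thesis
    by (simp add: partial2_truncate truncate_mult[symmetric] truncate_add[symmetric] pderiv_mult)
qed

lemma partial1_mult: "partial1 (f * g) = f * partial1 g + g * partial1 (f :: 'a trunc_poly)"
  by (simp add: partial1_swap swap_vars_mult partial2_mult swap_vars_add swap_swap)

lemma witt_bracket_commutator:
  "witt_apply (witt_bracket D E) f =
     witt_apply D (witt_apply E f) - witt_apply E (witt_apply D (f :: 'a trunc_poly))"
  by (cases D; cases E) (simp add: partial_add partial1_mult partial2_mult partial_commute algebra_simps)

lemma er_lie_algebra: "lie_algebra (er_scale :: 'a \<Rightarrow> _) er_bracket"
proof -
  have vs: "vector_space (er_scale :: 'a \<Rightarrow> _)"
    by unfold_locales (auto simp: plus_prod_def tscale_simps)
  interpret vector_space "er_scale :: 'a \<Rightarrow> _" by (rule vs)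
  show ?thesis
  proof (unfold_locales, goal_cases)
    case (1 y b1 b2)
    then show ?case
      by (cases y; cases b1; cases b2) (auto simp: plus_prod_def minus_prod_def div_act_def
           partial_add partial_diff algebra_simps)
  next
    case (2 y c b)
    then show ?case
      by (cases y; cases b) (auto simp: plus_prod_def minus_prod_def div_act_def
           partial_scale tscale_simps tscale_mult algebra_simps)
  next
    case (3 y b1 b2)
    then show ?case
      by (cases y; cases b1; cases b2) (auto simp: plus_prod_def minus_prod_def div_act_def
           partial_add partial_diff algebra_simps)
  next
    case (4 y c b)
    then show ?case
      by (cases y; cases b) (auto simp: plus_prod_def minus_prod_def div_act_def
           partial_scale tscale_simps tscale_mult algebra_simps)
  next
    case (5 x)
    then show ?case
      by (cases x) (auto simp: zero_prod_def plus_prod_def div_act_def)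
  next
    case (6 x y z)
    obtain f1 f2 f where x: "x = ((f1,f2),f)" by (cases x) auto
    obtain g1 g2 g where y: "y = ((g1,g2),g)" by (cases y) auto
    obtain h1 h2 h where z: "z = ((h1,h2),h)" by (cases z) auto
    show ?case
      by (simp add: x y z zero_prod_def plus_prod_def div_act_def
          partial_add partial_diff partial1_mult partial2_mult partial_commute)
        (simp add: algebra_simps three_trunc)
  qed
qed

end

end

theory Submission
  imports Defs
begin

text \<open>
  The five roots occurring in the two generators form the extended Dynkin diagram of type F4: four of
  them are a base, the fifth is its lowest root.  The Jacobi identity over the complex numbers and the
  absolute values of the structure constants show that, around every square of roots
  \<open>\<delta>, \<delta> + \<alpha>, \<delta> + \<beta>, \<delta> + \<alpha> + \<beta>\<close> with affine simple \<open>\<alpha>\<close> and \<open>\<beta>\<close>, the signs of the structure constants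
  cancel.  Hence the basis can be rescaled so that the five root vectors act with known
  coefficients, and the adjoint action of the two generators becomes an explicit pair of matrices over
  the prime field.

  These matrices show that 26 explicit vectors span the generated subalgebra \<open>L\<close>, on which the generators
  act as \<open>\<partial>\<^sub>1 + x\<^sub>1\<^sup>2 \<partial>\<^sub>2\<close> and \<open>x\<^sub>1 x\<^sub>2\<^sup>2\<close> act on the restricted Ermolaev algebra; a linear bijection that
  intertwines the actions of generators is an isomorphism.  For maximality, the quotient of the whole
  algebra by \<open>L\<close> is an irreducible \<open>L\<close>-module: the first generator acts nilpotently on it with a kernel of
  dimension three, every nonzero vector of that kernel can be moved to one particular vector, and that
  vector generates the quotient.
\<close>

section \<open>The root system\<close>

text \<open>The roots are listed by increasing \<open>level\<close>, defined below.\<close>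

definition root_list :: "root list" where
  "root_list = [
   (-1,-2,-3,-2), (0,0,0,1), (0,1,0,0), (0,1,2,0), (1,0,0,0), (-1,-2,-3,-1),
   (0,1,2,1), (1,1,0,0), (1,1,2,0), (-1,-1,-1,-1), (0,1,2,2), (1,1,2,1),
   (1,2,2,0), (-1,-1,-1,0), (0,-1,-1,-1), (1,1,2,2), (1,2,2,1), (-2,-3,-4,-2),
   (0,-1,-1,0), (0,0,-1,-1), (1,2,2,2), (1,2,4,2), (-1,-3,-4,-2), (0,0,-1,0),
   (0,0,1,0), (1,3,4,2), (-1,-2,-4,-2), (-1,-2,-2,-2), (0,0,1,1), (0,1,1,0),
   (2,3,4,2), (-1,-2,-2,-1), (-1,-1,-2,-2), (0,1,1,1), (1,1,1,0), (-1,-2,-2,0),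
   (-1,-1,-2,-1), (0,-1,-2,-2), (1,1,1,1), (-1,-1,-2,0), (-1,-1,0,0), (0,-1,-2,-1),
   (1,2,3,1), (-1,0,0,0), (0,-1,-2,0), (0,-1,0,0), (0,0,0,-1), (1,2,3,2)]"

lemma mem_roots: "\<alpha> \<in> roots \<longleftrightarrow> root_form \<alpha> \<alpha> = 2 \<or> root_form \<alpha> \<alpha> = 4"
  by (simp add: roots_def)

text \<open>Completing the square in a, then b, then c, with denominators cleared. This shows
  positive definiteness, and each square bounds one coordinate of a root in terms of the
  next.\<close>

lemma root_form_sum_squares:
  "6 * root_form (a, b, c, d) (a, b, c, d) =
     6 * (2 * a - b)\<^sup>2 + 2 * (3 * b - 2 * c)\<^sup>2 + (2 * c - 3 * d)\<^sup>2 + 3 * d\<^sup>2"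
  by (simp add: power2_eq_square algebra_simps)

text \<open>The simplifier evaluates \<open>if\<close> lazily but an implication eagerly, so this keeps exhaustive checks cheap.\<close>

lemma imp_conv_if: "(P \<longrightarrow> Q) = (if P then Q else True)"
  by simp

lemma roots_eq: "roots = set root_list"
proof
  show "set root_list \<subseteq> roots"
  proof
    fix \<alpha> assume "\<alpha> \<in> set root_list"
    moreover have "\<forall>\<alpha>\<in>set root_list. root_form \<alpha> \<alpha> = 2 \<or> root_form \<alpha> \<alpha> = 4"
      by code_simp
    ultimately show "\<alpha> \<in> roots" by (auto simp: mem_roots)
  qed
next
  \<comment> \<open>Each guard limits a coordinate by one already fixed, so most of the box is never
    searched.\<close>
  have enum: "\<forall>d\<in>set [-2..2]. \<forall>c\<in>set [-5..5]. \<bar>2 * c - 3 * d\<bar> \<le> 4 \<longrightarrow>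
      (\<forall>b\<in>set [-4..4]. \<bar>3 * b - 2 * c\<bar> \<le> 3 \<longrightarrow> (\<forall>a\<in>set [-3..3]. \<bar>2 * a - b\<bar> \<le> 2 \<longrightarrow>
        root_form (a, b, c, d) (a, b, c, d) = 2 \<or> root_form (a, b, c, d) (a, b, c, d) = 4 \<longrightarrow>
        (a, b, c, d) \<in> set root_list))"
    unfolding imp_conv_if by code_simp
  have sq: "\<bar>x\<bar> \<le> n" if "x\<^sup>2 < (n + 1)\<^sup>2" "0 \<le> n" for x n :: int
    using that abs_le_square_iff[of "n + 1" x] by (cases "\<bar>x\<bar> \<le> n") auto
  show "roots \<subseteq> set root_list"
  proof
    fix \<alpha> :: root assume \<alpha>: "\<alpha> \<in> roots"
    obtain a b c d where abcd: "\<alpha> = (a, b, c, d)" by (cases \<alpha>) auto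
    have le: "6 * (2 * a - b)\<^sup>2 + 2 * (3 * b - 2 * c)\<^sup>2 + (2 * c - 3 * d)\<^sup>2 + 3 * d\<^sup>2 \<le> 24"
      using \<alpha> root_form_sum_squares[of a b c d] unfolding mem_roots abcd by linarith
    have nonneg: "0 \<le> (2 * a - b)\<^sup>2" "0 \<le> (3 * b - 2 * c)\<^sup>2" "0 \<le> (2 * c - 3 * d)\<^sup>2" "0 \<le> d\<^sup>2"
      by simp_all
    \<comment> \<open>Each square is at most 24 divided by its coefficient; the bounds are the next
      perfect squares.\<close>
    have "d\<^sup>2 < 9" "(2 * c - 3 * d)\<^sup>2 < 25" "(3 * b - 2 * c)\<^sup>2 < 16" "(2 * a - b)\<^sup>2 < 9"
      using le nonneg by linarith+
    then have *: "\<bar>d\<bar> \<le> 2" "\<bar>2 * c - 3 * d\<bar> \<le> 4" "\<bar>3 * b - 2 * c\<bar> \<le> 3" "\<bar>2 * a - b\<bar> \<le> 2"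
      using sq[of d 2] sq[of "2 * c - 3 * d" 4] sq[of "3 * b - 2 * c" 3] sq[of "2 * a - b" 2] by simp_all
    have "d \<in> set [-2..2]" "c \<in> set [-5..5]" "b \<in> set [-4..4]" "a \<in> set [-3..3]"
      using * by auto
    then show "\<alpha> \<in> set root_list"
      using enum * \<alpha> unfolding mem_roots abcd by blast
  qed
qed

text \<open>The number \<open>r + 1\<close> for the \<open>\<alpha>\<close>-string through \<open>\<beta>\<close> when \<open>\<alpha> + \<beta>\<close> is a root: \<open>\<beta> - \<alpha>\<close> is then
  a root exactly for orthogonal (hence short) \<open>\<alpha>\<close>, \<open>\<beta>\<close>.\<close>

definition string_const :: "root \<Rightarrow> root \<Rightarrow> int" where
  "string_const \<alpha> \<beta> = (if root_form \<alpha> \<beta> = 0 then 2 else 1)"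

lemma root_form_diff:
  "root_form (\<beta> - root_mult r \<alpha>) (\<beta> - root_mult r \<alpha>) =
     root_form \<beta> \<beta> - 2 * r * root_form \<alpha> \<beta> + r\<^sup>2 * root_form \<alpha> \<alpha>"
  by (cases \<alpha>; cases \<beta>) (simp add: power2_eq_square algebra_simps)

lemma root_form_add:
  "root_form (\<alpha> + \<beta>) (\<alpha> + \<beta>) = root_form \<alpha> \<alpha> + root_form \<beta> \<beta> + 2 * root_form \<alpha> \<beta>"
  by (cases \<alpha>; cases \<beta>) (simp add: algebra_simps)

text \<open>The norm of \<alpha> + \<beta> is at most 4, so the product (\<alpha>,\<beta>) is not
  positive. If it is 0, both roots are short, \<beta> - r\<alpha> has norm 2 + 2r^2, and exactly r =
  0, 1 remain. If it is negative, \<beta> - r\<alpha> with r at least 1 is longer than a long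
  root.\<close>

lemma root_string_down_eq:
  assumes "\<alpha> \<in> roots" "\<beta> \<in> roots" "\<alpha> + \<beta> \<in> roots"
  shows "int (root_string_down \<alpha> \<beta>) + 1 = string_const \<alpha> \<beta>"
proof -
  let ?m = "root_form \<alpha> \<beta>"
  have cases: "?m = 0 \<and> root_form \<alpha> \<alpha> = 2 \<and> root_form \<beta> \<beta> = 2 \<or> ?m \<le> -1"
    using assms root_form_add[of \<alpha> \<beta>] unfolding mem_roots by auto
  have big: "\<beta> - root_mult (int r) \<alpha> \<notin> roots" if "?m \<le> -1" "r \<ge> 1" for r
  proof -
    have "1 \<le> int r" "1 \<le> (int r)\<^sup>2" using that by simp_all
    then have "2 * 1 * 1 \<le> 2 * int r * (- ?m)" "1 * 2 \<le> (int r)\<^sup>2 * root_form \<alpha> \<alpha>"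
      using that assms(1) unfolding mem_roots by (intro mult_mono; auto)+
    moreover have "2 * 1 * 1 + 1 * 4 > (4::int)" by simp
    moreover have "root_form \<beta> \<beta> \<ge> 2" using assms(2) unfolding mem_roots by auto
    ultimately have "root_form \<beta> \<beta> - 2 * int r * ?m + (int r)\<^sup>2 * root_form \<alpha> \<alpha> > 4" by simp
    then show ?thesis unfolding mem_roots root_form_diff by simp
  qed
  have [simp]: "root_mult 0 \<alpha> = 0" by (cases \<alpha>) (simp add: zero_prod_def)
  show ?thesis
  proof (cases "?m = 0")
    case True
    with cases have 2: "root_form \<alpha> \<alpha> = 2" "root_form \<beta> \<beta> = 2" by auto
    have "\<beta> - root_mult (int r) \<alpha> \<in> roots \<longleftrightarrow> r \<le> 1" for r
    proof (cases "r \<le> 1")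
      case True
      then have "r = 0 \<or> r = 1" by auto
      then show ?thesis unfolding mem_roots root_form_diff using \<open>?m = 0\<close> 2 by auto
    next
      case False
      then have "2\<^sup>2 \<le> (int r)\<^sup>2" by (intro power_mono) auto
      then show ?thesis unfolding mem_roots root_form_diff using False \<open>?m = 0\<close> 2 by auto
    qed
    then have "{r. \<beta> - root_mult (int r) \<alpha> \<in> roots} = {..1}" by auto
    then have "root_string_down \<alpha> \<beta> = 1"
      unfolding root_string_down_def by (simp add: atMost_Suc)
    then show ?thesis using True by (simp add: string_const_def)
  next
    case False
    then have "\<beta> - root_mult (int r) \<alpha> \<in> roots \<longleftrightarrow> r = 0" for r
      using big[of r] cases assms(2) by (cases "r = 0") auto
    then have "{r. \<beta> - root_mult (int r) \<alpha> \<in> roots} = {0}"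
      by auto
    then show ?thesis using False by (simp add: root_string_down_def string_const_def)
  qed
qed

text \<open>The roots occurring in the two generators, ordered along the chain of the extended Dynkin diagram:
  the last four are a base of type F4 and the first is its lowest root.\<close>

definition affine_simple :: "root list" where
  "affine_simple = [(0,1,0,0), (1,0,0,0), (0,1,2,0), (0,0,0,1), (-1,-2,-3,-2)]"

text \<open>The height in that base modulo the Coxeter number 12; every affine simple root has level 1.\<close>

fun level :: "root \<Rightarrow> int" where
  "level (a, b, c, d) = (a + b + 6 * c + d) mod 12"

text \<open>A sign alternating along the extended Dynkin diagram.\<close>

definition colour :: "root \<Rightarrow> int" where
  "colour \<alpha> = (if \<alpha> = (1,0,0,0) \<or> \<alpha> = (0,0,0,1) then -1 else 1)"

section \<open>Levels and squares of roots, checked by enumeration\<close>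

lemma level_roots: "\<forall>\<alpha>\<in>roots. 1 \<le> level \<alpha> \<and> level \<alpha> \<le> 11"
  unfolding roots_eq imp_conv_if by code_simp

lemma level_affine_simple: "\<forall>\<alpha>\<in>set affine_simple. \<alpha> \<in> roots \<and> level \<alpha> = 1"
  unfolding mem_roots by code_simp

lemma level_add:
  "\<forall>\<alpha>\<in>set affine_simple. \<forall>\<beta>\<in>roots. \<alpha> + \<beta> \<in> roots \<longrightarrow> level (\<alpha> + \<beta>) = level \<beta> + 1"
  unfolding mem_roots[of "_ + _"] unfolding roots_eq imp_conv_if by code_simp

lemma level_ge_2:
  "\<forall>\<gamma>\<in>roots. level \<gamma> \<ge> 2 \<longrightarrow> (\<exists>\<alpha>\<in>set affine_simple. \<gamma> - \<alpha> \<in> roots)"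
  unfolding mem_roots[of "_ - _"] unfolding roots_eq imp_conv_if by code_simp

text \<open>Two edges into the same root close up to a square below it. At level 2 there is no lower
  corner: the two sources are the affine simple roots themselves. These are the two cases of
  well-definedness in \<open>signs_upto\<close>.\<close>

lemma roots_in_square:
  "\<forall>\<gamma>\<in>roots. \<forall>\<alpha>\<in>set affine_simple. \<gamma> - \<alpha> \<in> roots \<longrightarrow> (\<forall>\<beta>\<in>set affine_simple.
     \<alpha> \<noteq> \<beta> \<longrightarrow> \<gamma> - \<beta> \<in> roots \<longrightarrow>
       (if level \<gamma> = 2 then \<gamma> = \<alpha> + \<beta> \<and> colour \<alpha> = - colour \<beta> else \<gamma> - \<alpha> - \<beta> \<in> roots))"
  unfolding mem_roots[of "_ - _"] unfolding roots_eq imp_conv_if by code_simp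

text \<open>For the two products x and y of structure constants along the sides of a square, the
  Jacobi identity fixes the absolute value of x - y. The inequality says that it is not |x| + |y|,
  which excludes opposite signs.\<close>

lemma square_consts:
  "\<forall>\<delta>\<in>roots. \<forall>\<alpha>\<in>set affine_simple. \<alpha> + \<delta> \<in> roots \<longrightarrow> (\<forall>\<beta>\<in>set affine_simple.
     \<alpha> \<noteq> \<beta> \<longrightarrow> \<beta> + \<delta> \<in> roots \<longrightarrow> \<alpha> + \<beta> + \<delta> \<in> roots \<longrightarrow>
       \<alpha> + \<beta> \<noteq> 0 \<and>
       (if \<alpha> + \<beta> \<in> roots then string_const \<alpha> \<beta> * string_const (\<alpha> + \<beta>) \<delta> else 0) \<noteq>
         string_const \<beta> \<delta> * string_const \<alpha> (\<beta> + \<delta>) + string_const \<alpha> \<delta> * string_const \<beta> (\<alpha> + \<delta>))"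
  unfolding mem_roots[of "_ + _"] unfolding roots_eq imp_conv_if by code_simp

section \<open>Signs of the structure constants\<close>

context lie_algebra
begin

lemma bracket_add_left: "bracket (x + y) z = bracket x z + bracket y z"
  using linear_left unfolding Vector_Spaces.linear_iff by blast

lemma bracket_add_right: "bracket x (y + z) = bracket x y + bracket x z"
  using linear_right unfolding Vector_Spaces.linear_iff by blast

lemma bracket_scale_left: "bracket (c *s x) y = c *s bracket x y"
  using linear_left unfolding Vector_Spaces.linear_iff by blast

lemma bracket_scale_right: "bracket x (c *s y) = c *s bracket x y"
  using linear_right unfolding Vector_Spaces.linear_iff by blast

lemma bracket_zero [simp]: "bracket 0 x = 0" "bracket x 0 = 0"
  using bracket_scale_left[of 0 0 x] bracket_scale_right[of x 0 0] by simp_all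

lemma bracket_antisym: "bracket x y = - bracket y x"
proof -
  have "0 = bracket (x + y) (x + y)" by (simp only: alternating)
  also have "\<dots> = bracket x y + bracket y x"
    unfolding bracket_add_left bracket_add_right by (simp add: alternating)
  finally show ?thesis by (simp add: eq_neg_iff_add_eq_0)
qed

lemma bracket_minus_right: "bracket x (- y) = - bracket x y"
  using bracket_scale_right[of x "-1" y] by simp

lemma bracket_bracket: "bracket (bracket x y) z = bracket x (bracket y z) - bracket y (bracket x z)"
proof -
  have "bracket y (bracket z x) = - bracket y (bracket x z)"
    by (subst bracket_antisym[of z x]) (rule bracket_minus_right)
  then show ?thesis
    using jacobi[of x y z] bracket_antisym[of z "bracket x y"] by (simp add: algebra_simps)
qed

end

section \<open>Relations between structure constants from the Jacobi identity\<close>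

lemma roots_uminus: "- \<alpha> \<in> roots" if "\<alpha> \<in> roots"
  using that by (cases \<alpha>) (simp add: mem_roots)

context F4_chevalley_basis
begin

lemma e_nonzero: "\<alpha> \<in> roots \<Longrightarrow> e \<alpha> \<noteq> 0"
  using independent dependent_zero[of "e ` roots \<union> h ` {1..4}"] by (metis UnI1 image_eqI)

lemma e_scale_cancel: "\<alpha> \<in> roots \<Longrightarrow> a *s e \<alpha> = b *s e \<alpha> \<longleftrightarrow> a = b"
  using e_nonzero[of \<alpha>] by simp

lemma h_sum_cancel:
  assumes "(\<Sum>i\<in>{1..4}. a i *s h i) = (\<Sum>i\<in>{1..4}. b i *s h i)" "i \<in> {1..4}"
  shows "a i = b i"
proof -
  have indep: "independent (h ` {1..4})"
    by (rule independent_mono[OF independent]) simp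
  define g where "g = inv_into {1..4} h"
  have g: "g (h j) = j" if "j \<in> {1..4}" for j
    unfolding g_def using inj_h that by (rule inv_into_f_f)
  have "(\<Sum>v\<in>h ` {1..4}. (a (g v) - b (g v)) *s v) = (\<Sum>j\<in>{1..4}. (a j - b j) *s h j)"
    using g by (subst sum.reindex[OF inj_h]) (auto intro!: sum.cong)
  also have "\<dots> = 0"
    using assms(1) by (simp add: scale_left_diff_distrib sum_subtractf)
  finally have "a (g (h i)) - b (g (h i)) = 0"
    using indep assms(2) by (intro independentD[OF indep, where u = "\<lambda>v. a (g v) - b (g v)"]) auto
  then show ?thesis using g assms(2) by simp
qed

text \<open>The Jacobi identity for \<open>e \<alpha>\<close>, \<open>e \<beta>\<close>,
  \<open>e \<delta>\<close>, compared at the root vector of the sum.\<close>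

lemma N_square:
  assumes "\<alpha> \<in> roots" "\<beta> \<in> roots" "\<delta> \<in> roots" "\<alpha> + \<delta> \<in> roots" "\<beta> + \<delta> \<in> roots"
    and sum: "\<alpha> + \<beta> + \<delta> \<in> roots" and "\<alpha> + \<beta> \<noteq> 0"
  shows "(of_int (N \<beta> \<delta> * N \<alpha> (\<beta> + \<delta>) - N \<alpha> \<delta> * N \<beta> (\<alpha> + \<delta>)) :: 'k) =
    of_int (if \<alpha> + \<beta> \<in> roots then N \<alpha> \<beta> * N (\<alpha> + \<beta>) \<delta> else 0)"
proof -
  have sum': "\<alpha> + (\<beta> + \<delta>) \<in> roots" "\<beta> + (\<alpha> + \<delta>) \<in> roots" "\<beta> + (\<alpha> + \<delta>) = \<alpha> + \<beta> + \<delta>"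
    using sum by (simp_all add: ac_simps)
  have e1: "bracket (e \<alpha>) (bracket (e \<beta>) (e \<delta>)) = of_int (N \<beta> \<delta> * N \<alpha> (\<beta> + \<delta>)) *s e (\<alpha> + \<beta> + \<delta>)"
    using assms(1-5) sum'(1) by (simp add: e_e bracket_scale_right add.assoc)
  have e2: "bracket (e \<beta>) (bracket (e \<alpha>) (e \<delta>)) = of_int (N \<alpha> \<delta> * N \<beta> (\<alpha> + \<delta>)) *s e (\<alpha> + \<beta> + \<delta>)"
    unfolding sum'(3)[symmetric] using assms(1-5) sum'(2) by (simp add: e_e bracket_scale_right)
  have "bracket (e \<alpha>) (bracket (e \<beta>) (e \<delta>)) - bracket (e \<beta>) (bracket (e \<alpha>) (e \<delta>)) =
      of_int (N \<beta> \<delta> * N \<alpha> (\<beta> + \<delta>) - N \<alpha> \<delta> * N \<beta> (\<alpha> + \<delta>)) *s e (\<alpha> + \<beta> + \<delta>)"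
    unfolding e1 e2 by (simp add: scale_left_diff_distrib)
  moreover have "bracket (bracket (e \<alpha>) (e \<beta>)) (e \<delta>) =
      of_int (if \<alpha> + \<beta> \<in> roots then N \<alpha> \<beta> * N (\<alpha> + \<beta>) \<delta> else 0) *s e (\<alpha> + \<beta> + \<delta>)"
    using assms by (simp add: e_e e_e_0 bracket_scale_left)
  ultimately show ?thesis
    using bracket_bracket[of "e \<alpha>" "e \<beta>" "e \<delta>"] e_scale_cancel[OF sum] by metis
qed

text \<open>The Jacobi identity for three roots of sum zero. All its terms lie in the Cartan
  subalgebra and are compared at \<open>h i\<close>.\<close>

lemma N_opposite:
  assumes "\<alpha> \<in> roots" "\<beta> \<in> roots" "\<alpha> + \<beta> \<in> roots" "i \<in> {1..4}"
  shows "(of_int (N \<beta> (- (\<alpha> + \<beta>)) * coroot_coeff \<alpha> i - N \<alpha> (- (\<alpha> + \<beta>)) * coroot_coeff \<beta> i) :: 'k) =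
    of_int (N \<alpha> \<beta> * coroot_coeff (\<alpha> + \<beta>) i)"
proof -
  define \<delta> where "\<delta> = - (\<alpha> + \<beta>)"
  have \<delta>: "\<delta> \<in> roots" "\<beta> + \<delta> = - \<alpha>" "\<alpha> + \<delta> = - \<beta>" "- \<alpha> \<in> roots" "- \<beta> \<in> roots"
    using roots_uminus[OF assms(1)] roots_uminus[OF assms(2)] roots_uminus[OF assms(3)]
    by (simp_all only: \<delta>_def) simp_all
  have e1: "bracket (e \<alpha>) (bracket (e \<beta>) (e \<delta>)) =
      of_int (N \<beta> \<delta>) *s (\<Sum>i\<in>{1..4}. of_int (coroot_coeff \<alpha> i) *s h i)"
    using e_e[of \<beta> \<delta>] \<delta> assms by (simp add: bracket_scale_right e_opposite)
  have e2: "bracket (e \<beta>) (bracket (e \<alpha>) (e \<delta>)) =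
      of_int (N \<alpha> \<delta>) *s (\<Sum>i\<in>{1..4}. of_int (coroot_coeff \<beta> i) *s h i)"
    using e_e[of \<alpha> \<delta>] \<delta> assms by (simp add: bracket_scale_right e_opposite)
  have e3: "bracket (bracket (e \<alpha>) (e \<beta>)) (e \<delta>) =
      of_int (N \<alpha> \<beta>) *s (\<Sum>i\<in>{1..4}. of_int (coroot_coeff (\<alpha> + \<beta>) i) *s h i)"
    using e_e[of \<alpha> \<beta>] e_opposite[of "\<alpha> + \<beta>"] assms unfolding \<delta>_def by (simp only: bracket_scale_left)
  have "(\<Sum>i\<in>{1..4}. of_int (N \<beta> \<delta> * coroot_coeff \<alpha> i - N \<alpha> \<delta> * coroot_coeff \<beta> i) *s h i) =
      (\<Sum>i\<in>{1..4}. of_int (N \<alpha> \<beta> * coroot_coeff (\<alpha> + \<beta>) i) *s h i)"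
    using bracket_bracket[of "e \<alpha>" "e \<beta>" "e \<delta>"] unfolding e1 e2 e3
    by (simp add: scale_sum_right scale_left_diff_distrib sum_subtractf)
  then show ?thesis unfolding \<delta>_def using assms(4) by (rule h_sum_cancel)
qed

end

text \<open>The coroots of neighbours in the extended diagram are independent, and the coroot of
  \<alpha> + \<beta> is a combination of them with positive coefficients. Hence x has the sign of z
  and y the opposite one.\<close>

lemma sgn_coroot_relation:
  fixes x y z :: int
  assumes "(\<alpha>, \<beta>) \<in> set (zip affine_simple (tl affine_simple))"
    and rel: "\<And>i. i \<in> {1..4} \<Longrightarrow> x * coroot_coeff \<alpha> i - y * coroot_coeff \<beta> i = z * coroot_coeff (\<alpha> + \<beta>) i"
  shows "sgn x = - sgn y"
proof -
  have "\<alpha> = (0,1,0,0) \<and> \<beta> = (1,0,0,0) \<or> \<alpha> = (1,0,0,0) \<and> \<beta> = (0,1,2,0) \<or>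
      \<alpha> = (0,1,2,0) \<and> \<beta> = (0,0,0,1) \<or> \<alpha> = (0,0,0,1) \<and> \<beta> = (-1,-2,-3,-2)"
    using assms by (simp add: affine_simple_def)
  then show ?thesis
    using rel[of 1] rel[of 2] rel[of 3] rel[of 4]
    by (elim disjE) (auto simp: coroot_coeff_def simple_root_def sgn_if)
qed

text \<open>Integer identities for \<open>N\<close>, obtained from the complex basis because
  \<open>of_int\<close> is injective there. The locale carries them over to characteristic 3, where
  the bracket determines \<open>N\<close> only modulo 3.\<close>

locale F4_constants =
  fixes N :: "root \<Rightarrow> root \<Rightarrow> int"
  assumes abs_N: "\<lbrakk>\<alpha> \<in> roots; \<beta> \<in> roots; \<alpha> + \<beta> \<in> roots\<rbrakk> \<Longrightarrow> \<bar>N \<alpha> \<beta>\<bar> = string_const \<alpha> \<beta>"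
    and square: "\<lbrakk>\<alpha> \<in> roots; \<beta> \<in> roots; \<delta> \<in> roots; \<alpha> + \<delta> \<in> roots; \<beta> + \<delta> \<in> roots;
      \<alpha> + \<beta> + \<delta> \<in> roots; \<alpha> + \<beta> \<noteq> 0\<rbrakk> \<Longrightarrow>
      N \<beta> \<delta> * N \<alpha> (\<beta> + \<delta>) - N \<alpha> \<delta> * N \<beta> (\<alpha> + \<delta>) =
        (if \<alpha> + \<beta> \<in> roots then N \<alpha> \<beta> * N (\<alpha> + \<beta>) \<delta> else 0)"
    and opposite: "\<lbrakk>\<alpha> \<in> roots; \<beta> \<in> roots; \<alpha> + \<beta> \<in> roots; i \<in> {1..4}\<rbrakk> \<Longrightarrow>
      N \<beta> (- (\<alpha> + \<beta>)) * coroot_coeff \<alpha> i - N \<alpha> (- (\<alpha> + \<beta>)) * coroot_coeff \<beta> i =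
        N \<alpha> \<beta> * coroot_coeff (\<alpha> + \<beta>) i"
begin

text \<open>If the two products had opposite signs, or one were 0, the absolute value of their
  difference would be the sum of their absolute values, against
  \<open>square_consts\<close>.\<close>

lemma sgn_N_square:
  assumes "\<alpha> \<in> set affine_simple" "\<beta> \<in> set affine_simple" "\<alpha> \<noteq> \<beta>"
    and "\<delta> \<in> roots" "\<alpha> + \<delta> \<in> roots" "\<beta> + \<delta> \<in> roots" "\<alpha> + \<beta> + \<delta> \<in> roots"
  shows "sgn (N \<beta> \<delta>) * sgn (N \<alpha> (\<beta> + \<delta>)) = sgn (N \<alpha> \<delta>) * sgn (N \<beta> (\<alpha> + \<delta>))"
proof -
  let ?x = "N \<beta> \<delta> * N \<alpha> (\<beta> + \<delta>)" and ?y = "N \<alpha> \<delta> * N \<beta> (\<alpha> + \<delta>)"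
    and ?z = "if \<alpha> + \<beta> \<in> roots then N \<alpha> \<beta> * N (\<alpha> + \<beta>) \<delta> else 0"
  have roots: "\<alpha> \<in> roots" "\<beta> \<in> roots" using assms level_affine_simple by auto
  have ne: "\<alpha> + \<beta> \<noteq> 0" and
    strings: "(if \<alpha> + \<beta> \<in> roots then string_const \<alpha> \<beta> * string_const (\<alpha> + \<beta>) \<delta> else 0) \<noteq>
         string_const \<beta> \<delta> * string_const \<alpha> (\<beta> + \<delta>) + string_const \<alpha> \<delta> * string_const \<beta> (\<alpha> + \<delta>)"
    using square_consts assms by blast+
  have sum': "\<alpha> + (\<beta> + \<delta>) \<in> roots" "\<beta> + (\<alpha> + \<delta>) \<in> roots"
    using assms(7) by (simp_all add: ac_simps)
  have z: "?x - ?y = ?z" using square[OF roots assms(4-7) ne] .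
  have abs_z: "\<bar>?z\<bar> = (if \<alpha> + \<beta> \<in> roots then string_const \<alpha> \<beta> * string_const (\<alpha> + \<beta>) \<delta> else 0)"
    using abs_N roots assms by (simp add: abs_mult)
  have abs_xy: "\<bar>?x\<bar> = string_const \<beta> \<delta> * string_const \<alpha> (\<beta> + \<delta>)"
      "\<bar>?y\<bar> = string_const \<alpha> \<delta> * string_const \<beta> (\<alpha> + \<delta>)"
    using abs_N roots assms sum' by (simp_all add: abs_mult)
  have "\<bar>?x - ?y\<bar> \<noteq> \<bar>?x\<bar> + \<bar>?y\<bar>" unfolding z abs_z abs_xy by (rule strings)
  then have "sgn ?x = sgn ?y"
    by (auto simp: sgn_if abs_if split: if_splits)
  then show ?thesis by (simp add: sgn_mult)
qed

lemma sgn_N: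
  assumes "\<alpha> \<in> roots" "\<beta> \<in> roots" "\<alpha> + \<beta> \<in> roots"
  shows "sgn (N \<alpha> \<beta>) \<in> {1, -1}" "N \<alpha> \<beta> = sgn (N \<alpha> \<beta>) * string_const \<alpha> \<beta>"
proof -
  have "N \<alpha> \<beta> \<noteq> 0" using abs_N[OF assms] by (auto simp: string_const_def split: if_splits)
  then show "sgn (N \<alpha> \<beta>) \<in> {1, -1}" by (auto simp: sgn_if)
  show "N \<alpha> \<beta> = sgn (N \<alpha> \<beta>) * string_const \<alpha> \<beta>"
    using abs_N[OF assms] by (metis mult_sgn_abs)
qed

text \<open>Sign functions up to a given level, obtained by extending along an arbitrary edge into each new
  root: by \<open>sgn_N_square\<close> the choice does not matter.  The alternating signs on level 1 are forced by
  \<open>N \<alpha> \<beta> = - N \<beta> \<alpha>\<close>.\<close>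

lemma signs_upto:
  assumes antisym: "\<And>\<alpha> \<beta>. \<lbrakk>\<alpha> \<in> roots; \<beta> \<in> roots; \<alpha> + \<beta> \<in> roots\<rbrakk> \<Longrightarrow> N \<beta> \<alpha> = - N \<alpha> \<beta>"
  shows "\<exists>c. (\<forall>\<beta>. c \<beta> \<in> {1, -1}) \<and> (\<forall>\<alpha>\<in>set affine_simple. c \<alpha> = colour \<alpha>) \<and>
    (\<forall>\<alpha>\<in>set affine_simple. \<forall>\<beta>\<in>roots. \<alpha> + \<beta> \<in> roots \<longrightarrow> level (\<alpha> + \<beta>) \<le> int n \<longrightarrow>
      c (\<alpha> + \<beta>) = c \<beta> * sgn (N \<alpha> \<beta>))"
proof (induction n)
  case 0
  have "colour \<beta> \<in> {1, -1}" for \<beta> by (simp add: colour_def)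
  moreover have "\<not> level \<gamma> \<le> 0" if "\<gamma> \<in> roots" for \<gamma> using level_roots that by force
  ultimately show ?case by (intro exI[of _ colour]) auto
next
  case (Suc n)
  then obtain c where c: "\<And>\<beta>. c \<beta> \<in> {1, -1}" "\<And>\<alpha>. \<alpha> \<in> set affine_simple \<Longrightarrow> c \<alpha> = colour \<alpha>"
    "\<And>\<alpha> \<beta>. \<lbrakk>\<alpha> \<in> set affine_simple; \<beta> \<in> roots; \<alpha> + \<beta> \<in> roots; level (\<alpha> + \<beta>) \<le> int n\<rbrakk> \<Longrightarrow>
      c (\<alpha> + \<beta>) = c \<beta> * sgn (N \<alpha> \<beta>)"
    by metis
  define into where "into \<gamma> = (SOME \<alpha>. \<alpha> \<in> set affine_simple \<and> \<gamma> - \<alpha> \<in> roots)" for \<gamma>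
  \<comment> \<open>The last conjunct matters for n = 0: roots of level 1 are never recomputed and
    keep their \<open>colour\<close>.\<close>
  define new where "new \<gamma> \<longleftrightarrow> \<gamma> \<in> roots \<and> level \<gamma> = int (Suc n) \<and> level \<gamma> \<ge> 2" for \<gamma>
  define c' where "c' \<gamma> = (if new \<gamma> then c (\<gamma> - into \<gamma>) * sgn (N (into \<gamma>) (\<gamma> - into \<gamma>)) else c \<gamma>)" for \<gamma>
  have into: "into \<gamma> \<in> set affine_simple" "\<gamma> - into \<gamma> \<in> roots" if "new \<gamma>" for \<gamma>
    using someI_ex[of "\<lambda>\<alpha>. \<alpha> \<in> set affine_simple \<and> \<gamma> - \<alpha> \<in> roots"] level_ge_2 that
    unfolding new_def into_def by blast+
  have aff: "\<alpha> \<in> roots" "level \<alpha> = 1" if "\<alpha> \<in> set affine_simple" for \<alpha>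
    using level_affine_simple that by auto
  have pm: "c' \<beta> \<in> {1, -1}" for \<beta>
  proof (cases "new \<beta>")
    case True
    then have "sgn (N (into \<beta>) (\<beta> - into \<beta>)) \<in> {1, -1}"
      using into[OF True] aff by (intro sgn_N) (auto simp: new_def)
    then show ?thesis using c(1)[of "\<beta> - into \<beta>"] True by (auto simp: c'_def)
  next
    case False
    then show ?thesis using c(1)[of \<beta>] by (simp add: c'_def)
  qed
  have edge: "c' (\<alpha> + \<beta>) = c' \<beta> * sgn (N \<alpha> \<beta>)"
    if \<alpha>: "\<alpha> \<in> set affine_simple" and \<beta>: "\<beta> \<in> roots" "\<alpha> + \<beta> \<in> roots" "level (\<alpha> + \<beta>) \<le> int (Suc n)"
    for \<alpha> \<beta>
  proof -
    have lev: "level (\<alpha> + \<beta>) = level \<beta> + 1" "1 \<le> level \<beta>"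
      using level_add level_roots \<alpha> \<beta> by auto
    then have old: "c' \<beta> = c \<beta>" using \<beta>(3) by (auto simp: c'_def new_def)
    show ?thesis
    proof (cases "new (\<alpha> + \<beta>)")
      case False
      then have "level (\<alpha> + \<beta>) \<le> int n" using lev \<beta> by (auto simp: new_def)
      then show ?thesis using c(3)[OF \<alpha> \<beta>(1,2)] False old by (simp add: c'_def)
    next
      case True
      define \<gamma> where "\<gamma> = \<alpha> + \<beta>"
      define \<alpha>' where "\<alpha>' = into \<gamma>"
      define \<beta>' where "\<beta>' = \<gamma> - \<alpha>'"
      have \<gamma>: "new \<gamma>" "\<gamma> \<in> roots" "\<gamma> - \<alpha> \<in> roots" "\<gamma> - \<alpha> = \<beta>" using True \<beta> by (auto simp: \<gamma>_def)
      have \<alpha>': "\<alpha>' \<in> set affine_simple" and \<beta>': "\<beta>' \<in> roots" "\<alpha>' + \<beta>' = \<gamma>" "\<gamma> - \<alpha>' \<in> roots"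
        using into[OF \<gamma>(1)] by (auto simp: \<alpha>'_def \<beta>'_def)
      have c'\<gamma>: "c' \<gamma> = c \<beta>' * sgn (N \<alpha>' \<beta>')"
        using \<gamma>(1) by (simp add: c'_def \<alpha>'_def \<beta>'_def)
      have "c \<beta>' * sgn (N \<alpha>' \<beta>') = c \<beta> * sgn (N \<alpha> \<beta>)"
      proof (cases "\<alpha>' = \<alpha>")
        case True
        then show ?thesis using \<gamma>(4) by (simp add: \<beta>'_def)
      next
        case ne: False
        then have sq: "if level \<gamma> = 2 then \<gamma> = \<alpha> + \<alpha>' \<and> colour \<alpha> = - colour \<alpha>' else \<gamma> - \<alpha> - \<alpha>' \<in> roots"
          by (intro roots_in_square[rule_format, OF \<gamma>(2) \<alpha> \<gamma>(3) \<alpha>' _ \<beta>'(3)]) auto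
        show ?thesis
        proof (cases "level \<gamma> = 2")
          case True
          then have *: "\<beta> = \<alpha>'" "\<beta>' = \<alpha>" "colour \<alpha> = - colour \<alpha>'" using sq by (auto simp: \<gamma>_def \<beta>'_def)
          then have "N \<alpha>' \<alpha> = - N \<alpha> \<alpha>'"
            using antisym[of \<alpha> \<alpha>'] aff \<alpha> \<alpha>' \<beta> by auto
          then show ?thesis using * c(2)[OF \<alpha>] c(2)[OF \<alpha>'] by simp
        next
          case False
          define \<delta> where "\<delta> = \<gamma> - \<alpha> - \<alpha>'"
          have \<delta>: "\<delta> \<in> roots" "\<beta> = \<alpha>' + \<delta>" "\<beta>' = \<alpha> + \<delta>" "\<alpha> + \<alpha>' + \<delta> = \<gamma>"
            using sq False by (auto simp: \<delta>_def \<beta>'_def \<gamma>_def algebra_simps)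
          have lev': "level \<beta> \<le> int n" "level \<beta>' \<le> int n"
            using lev(1) \<beta>(3) level_add[rule_format, OF \<alpha>' \<beta>'(1)] \<beta>'(2) \<gamma>(2) by (auto simp: \<gamma>_def)
          have "c \<beta> = c \<delta> * sgn (N \<alpha>' \<delta>)" "c \<beta>' = c \<delta> * sgn (N \<alpha> \<delta>)"
            using c(3)[OF \<alpha>' \<delta>(1)] c(3)[OF \<alpha> \<delta>(1)] \<delta> \<beta> \<beta>' lev' by auto
          moreover have "sgn (N \<alpha>' \<delta>) * sgn (N \<alpha> (\<alpha>' + \<delta>)) = sgn (N \<alpha> \<delta>) * sgn (N \<alpha>' (\<alpha> + \<delta>))"
            using \<alpha> \<alpha>' ne \<delta> \<beta> \<beta>' \<gamma> by (intro sgn_N_square) auto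
          ultimately show ?thesis using \<delta>(2,3) by (simp add: mult.assoc)
        qed
      qed
      then show ?thesis using c'\<gamma> old by (simp add: \<gamma>_def)
    qed
  qed
  have base: "c' \<alpha> = colour \<alpha>" if "\<alpha> \<in> set affine_simple" for \<alpha>
    using c(2) aff[OF that] that by (auto simp: c'_def new_def)
  show ?case
    using pm edge base by (intro exI[of _ c']) blast
qed

lemma sgn_N_opposite:
  assumes "(\<alpha>, \<beta>) \<in> set (zip affine_simple (tl affine_simple))"
  shows "\<alpha> + \<beta> \<in> roots" "colour \<beta> = - colour \<alpha>" "sgn (N \<beta> (- (\<alpha> + \<beta>))) = - sgn (N \<alpha> (- (\<alpha> + \<beta>)))"
proof -
  have roots: "\<alpha> \<in> roots" "\<beta> \<in> roots"
    using assms level_affine_simple by (auto simp: affine_simple_def)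
  have "\<forall>(\<alpha>, \<beta>)\<in>set (zip affine_simple (tl affine_simple)). \<alpha> + \<beta> \<in> roots \<and> colour \<beta> = - colour \<alpha>"
    unfolding mem_roots by code_simp
  then show sum: "\<alpha> + \<beta> \<in> roots" and "colour \<beta> = - colour \<alpha>"
    using assms by blast+
  show "sgn (N \<beta> (- (\<alpha> + \<beta>))) = - sgn (N \<alpha> (- (\<alpha> + \<beta>)))"
    using assms opposite[OF roots sum] by (rule sgn_coroot_relation)
qed

text \<open>Level 11 is the highest, so the edge rule holds everywhere. What remains free is one
  sign \<open>s\<close>, which compares the values on the negatives of the affine simple roots with
  \<open>colour\<close>.\<close>

lemma signs:
  assumes antisym: "\<And>\<alpha> \<beta>. \<lbrakk>\<alpha> \<in> roots; \<beta> \<in> roots; \<alpha> + \<beta> \<in> roots\<rbrakk> \<Longrightarrow> N \<beta> \<alpha> = - N \<alpha> \<beta>"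
  obtains c s where "\<And>\<beta>. c \<beta> \<in> {1, -1}" "s \<in> {1, -1}"
    "\<And>\<alpha>. \<alpha> \<in> set affine_simple \<Longrightarrow> c \<alpha> = colour \<alpha>"
    "\<And>\<alpha>. \<alpha> \<in> set affine_simple \<Longrightarrow> c (- \<alpha>) = colour \<alpha> * s"
    "\<And>\<alpha> \<beta>. \<lbrakk>\<alpha> \<in> set affine_simple; \<beta> \<in> roots; \<alpha> + \<beta> \<in> roots\<rbrakk> \<Longrightarrow>
      c (\<alpha> + \<beta>) = c \<beta> * sgn (N \<alpha> \<beta>)"
proof -
  have top: "level \<gamma> \<le> int 11" if "\<gamma> \<in> roots" for \<gamma> using level_roots that by auto
  obtain c where "(\<forall>\<beta>. c \<beta> \<in> {1, -1}) \<and> (\<forall>\<alpha>\<in>set affine_simple. c \<alpha> = colour \<alpha>) \<and>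
      (\<forall>\<alpha>\<in>set affine_simple. \<forall>\<beta>\<in>roots. \<alpha> + \<beta> \<in> roots \<longrightarrow> level (\<alpha> + \<beta>) \<le> int 11 \<longrightarrow>
        c (\<alpha> + \<beta>) = c \<beta> * sgn (N \<alpha> \<beta>))"
    by (rule exE[OF signs_upto[OF antisym, of 11]])
  then have c: "\<And>\<beta>. c \<beta> \<in> {1, -1}" "\<And>\<alpha>. \<alpha> \<in> set affine_simple \<Longrightarrow> c \<alpha> = colour \<alpha>"
    and edge: "\<And>\<alpha> \<beta>. \<lbrakk>\<alpha> \<in> set affine_simple; \<beta> \<in> roots; \<alpha> + \<beta> \<in> roots\<rbrakk> \<Longrightarrow>
      c (\<alpha> + \<beta>) = c \<beta> * sgn (N \<alpha> \<beta>)"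
    using top by blast+
  \<comment> \<open>Both opposite roots are reached from -(\<alpha> + \<beta>), along edges whose
    signs are opposite.\<close>
  have flip: "c (- \<beta>) = - c (- \<alpha>)" if p: "(\<alpha>, \<beta>) \<in> set (zip affine_simple (tl affine_simple))" for \<alpha> \<beta>
  proof -
    have aff: "\<alpha> \<in> set affine_simple" "\<beta> \<in> set affine_simple"
      using set_zip_leftD[OF p] set_zip_rightD[OF p] by (auto simp: affine_simple_def)
    then have roots: "- \<alpha> \<in> roots" "- \<beta> \<in> roots" "- (\<alpha> + \<beta>) \<in> roots"
      using level_affine_simple roots_uminus sgn_N_opposite(1)[OF p] by blast+
    have "\<beta> + - (\<alpha> + \<beta>) = - \<alpha>" "\<alpha> + - (\<alpha> + \<beta>) = - \<beta>" by simp_all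
    then show ?thesis
      using edge[OF aff(2) roots(3)] edge[OF aff(1) roots(3)] roots sgn_N_opposite(3)[OF p] by simp
  qed
  \<comment> \<open>The root (0,1,0,0) has colour 1, so the value at its negative serves as
    \<open>s\<close>.\<close>
  have "c (- \<alpha>) = colour \<alpha> * c (- (0,1,0,0))" if "\<alpha> \<in> set affine_simple" for \<alpha>
    using that flip[of "(0,1,0,0)" "(1,0,0,0)"] flip[of "(1,0,0,0)" "(0,1,2,0)"]
      flip[of "(0,1,2,0)" "(0,0,0,1)"] flip[of "(0,0,0,1)" "(-1,-2,-3,-2)"]
    by (auto simp: affine_simple_def colour_def)
  then show ?thesis using that c edge by blast
qed

end

lemma (in F4_chevalley_basis) F4_constants:
  assumes inj: "inj (of_int :: int \<Rightarrow> 'k)"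
  shows "F4_constants N"
proof
  fix \<alpha> \<beta> assume *: "\<alpha> \<in> roots" "\<beta> \<in> roots" "\<alpha> + \<beta> \<in> roots"
  then show "\<bar>N \<alpha> \<beta>\<bar> = string_const \<alpha> \<beta>"
    using N_abs root_string_down_eq by simp
  show "N \<beta> (- (\<alpha> + \<beta>)) * coroot_coeff \<alpha> i - N \<alpha> (- (\<alpha> + \<beta>)) * coroot_coeff \<beta> i =
      N \<alpha> \<beta> * coroot_coeff (\<alpha> + \<beta>) i" if "i \<in> {1..4}" for i
    using N_opposite[OF * that] inj by (simp only: inj_eq)
next
  fix \<alpha> \<beta> \<delta> assume "\<alpha> \<in> roots" "\<beta> \<in> roots" "\<delta> \<in> roots" "\<alpha> + \<delta> \<in> roots" "\<beta> + \<delta> \<in> roots"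
      "\<alpha> + \<beta> + \<delta> \<in> roots" "\<alpha> + \<beta> \<noteq> 0"
  from N_square[OF this] show "N \<beta> \<delta> * N \<alpha> (\<beta> + \<delta>) - N \<alpha> \<delta> * N \<beta> (\<alpha> + \<delta>) =
        (if \<alpha> + \<beta> \<in> roots then N \<alpha> \<beta> * N (\<alpha> + \<beta>) \<delta> else 0)"
    using inj by (simp only: inj_eq)
qed

lemma (in F4_chevalley_basis) N_antisym:
  assumes inj: "inj (of_int :: int \<Rightarrow> 'k)" and "\<alpha> \<in> roots" "\<beta> \<in> roots" "\<alpha> + \<beta> \<in> roots"
  shows "N \<beta> \<alpha> = - N \<alpha> \<beta>"
proof -
  have "of_int (N \<beta> \<alpha>) *s e (\<alpha> + \<beta>) = bracket (e \<beta>) (e \<alpha>)"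
    using e_e[of \<beta> \<alpha>] assms by (simp add: add.commute)
  also have "\<dots> = of_int (- N \<alpha> \<beta>) *s e (\<alpha> + \<beta>)"
    using bracket_antisym[of "e \<beta>" "e \<alpha>"] e_e[of \<alpha> \<beta>] assms by simp
  finally have "(of_int (N \<beta> \<alpha>) :: 'k) = of_int (- N \<alpha> \<beta>)"
    using e_scale_cancel assms by blast
  then show ?thesis using inj by (simp only: inj_eq)
qed

section \<open>Computing with integral linear combinations modulo 3\<close>

text \<open>An index may be repeated in a list, so addition is concatenation and nothing has to be
  normalised before a comparison.\<close>

fun coef :: "('i \<times> int) list \<Rightarrow> 'i \<Rightarrow> int" where
  "coef [] i = 0"
| "coef ((j, a) # xs) i = (if i = j then a + coef xs i else coef xs i)"

definition eq_mod3 :: "('i \<times> int) list \<Rightarrow> ('i \<times> int) list \<Rightarrow> bool" where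
  "eq_mod3 xs ys \<longleftrightarrow> (\<forall>(i, _)\<in>set (xs @ ys). (coef xs i - coef ys i) mod 3 = 0)"

definition substitute :: "('i \<Rightarrow> ('j \<times> int) list) \<Rightarrow> ('i \<times> int) list \<Rightarrow> ('j \<times> int) list" where
  "substitute T xs = concat (map (\<lambda>(i, a). map (\<lambda>(j, b). (j, a * b)) (T i)) xs)"

context lie_algebra
begin

definition combination :: "('i \<Rightarrow> 'v) \<Rightarrow> ('i \<times> int) list \<Rightarrow> 'v" where
  "combination v xs = (\<Sum>(i, a)\<leftarrow>xs. of_int a *s v i)"

lemma combination_simps [simp]:
  "combination v [] = 0"
  "combination v ((i, a) # xs) = of_int a *s v i + combination v xs"
  by (simp_all add: combination_def)

lemma combination_append: "combination v (xs @ ys) = combination v xs + combination v ys"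
  by (simp add: combination_def)

lemma combination_sum:
  assumes "finite I" "fst ` set xs \<subseteq> I"
  shows "combination v xs = (\<Sum>i\<in>I. of_int (coef xs i) *s v i)"
  using assms(2)
proof (induction xs)
  case (Cons x xs)
  obtain j a where x: "x = (j, a)" by (cases x)
  have "(\<Sum>i\<in>I. of_int (coef (x # xs) i) *s v i) =
      (\<Sum>i\<in>I. (if i = j then of_int a *s v i else 0) + of_int (coef xs i) *s v i)"
    by (intro sum.cong) (auto simp: x scale_left_distrib)
  then show ?case
    using Cons assms(1) by (simp add: x sum.distrib sum.delta)
qed simp

lemma combination_in_subspace:
  "subspace S \<Longrightarrow> (\<And>i. i \<in> fst ` set xs \<Longrightarrow> v i \<in> S) \<Longrightarrow> combination v xs \<in> S"
  by (induction xs) (auto intro!: subspace_add subspace_scale subspace_0)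

lemma combination_map:
  "combination v (map (\<lambda>(j, b). (j, a * b)) xs) = of_int a *s combination v xs"
  by (induction xs) (auto simp: scale_right_distrib)

text \<open>This reduces vector identities in a new basis to identities of coefficient lists, which
  \<open>eq_mod3\<close> decides by evaluation.\<close>

lemma combination_substitute:
  "combination v (substitute T xs) = combination (\<lambda>i. combination v (T i)) xs"
  by (induction xs)
    (auto simp: substitute_def combination_append combination_map[unfolded case_prod_unfold] case_prod_unfold)

lemma combination_cong:
  "(\<And>i. i \<in> fst ` set xs \<Longrightarrow> v i = w i) \<Longrightarrow> combination v xs = combination w xs"
  by (induction xs) auto

lemma combination_eqI:
  assumes "CHAR('k) = 3" "eq_mod3 xs ys"
  shows "combination v xs = combination v ys"
proof -
  let ?I = "fst ` set (xs @ ys)"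
  have "(of_int (coef xs i) :: 'k) = of_int (coef ys i)" if "i \<in> ?I" for i
  proof -
    have "int CHAR('k) dvd coef xs i - coef ys i"
      using assms that by (auto simp: eq_mod3_def)
    then have "(of_int (coef xs i - coef ys i) :: 'k) = 0"
      using of_int_eq_0_iff_char_dvd by blast
    then show ?thesis by simp
  qed
  moreover have "combination v xs = (\<Sum>i\<in>?I. of_int (coef xs i) *s v i)"
      "combination v ys = (\<Sum>i\<in>?I. of_int (coef ys i) *s v i)"
    by (rule combination_sum; auto)+
  ultimately show ?thesis by simp
qed

end

lemma (in lie_algebra) bracket_combination_right:
  "bracket x (combination v xs) = combination (\<lambda>i. bracket x (v i)) xs"
  by (induction xs) (auto simp: bracket_add_right bracket_scale_right)

section \<open>A basis of the Lie algebra adapted to the subalgebra\<close>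

text \<open>In the base \<open>tl affine_simple\<close>, this is the coefficient of the last root, plus 2 for negative roots.
  Signs alone cannot normalise the structure constants, since the loop around the extended Dynkin diagram
  leaves a sign \<open>s\<close>; scaling \<open>e \<beta>\<close> by \<open>t ^ torus_exp \<beta>\<close> with \<open>t\<^sup>2 = s\<close> removes it and affects the
  generators only by the scalar \<open>t\<close> in the second one.\<close>

fun torus_exp :: "root \<Rightarrow> nat" where
  "torus_exp (a, b, c, d) = nat (c - 2 * b + (if a - 11 * b + 6 * c + d < 0 then 2 else 0))"

text \<open>The normalised bracket of the root vector of an affine simple root \<open>\<alpha>\<close> with a basis element, where
  \<open>Inl \<beta>\<close> stands for a multiple of \<open>e \<beta>\<close> and \<open>Inr i\<close> for \<open>h i\<close>.\<close>

definition affine_action :: "root \<Rightarrow> root + nat \<Rightarrow> ((root + nat) \<times> int) list" where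
  "affine_action \<alpha> x = (case x of
     Inl \<beta> \<Rightarrow>
       (let f = root_form (\<alpha> + \<beta>) (\<alpha> + \<beta>) in
        if f = 2 \<or> f = 4 then [(Inl (\<alpha> + \<beta>), string_const \<alpha> \<beta>)]
        else if f = 0 then map (\<lambda>i. (Inr i, colour \<alpha> * coroot_coeff \<alpha> i)) [1, 2, 3, 4]
        else [])
   | Inr i \<Rightarrow> [(Inl \<alpha>, - colour \<alpha> * cartan_integer \<alpha> (simple_root i))])"

text \<open>The first 26 vectors span the subalgebra; they correspond to the elements \<open>x\<^sub>1\<^sup>i x\<^sub>2\<^sup>j \<partial>\<^sub>1\<close>,
  \<open>x\<^sub>1\<^sup>i x\<^sub>2\<^sup>j \<partial>\<^sub>2\<close> and \<open>x\<^sub>1\<^sup>i x\<^sub>2\<^sup>j\<close> of the Ermolaev algebra in lexicographic order, with the two generators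
  corresponding to \<open>\<partial>\<^sub>1 + x\<^sub>1\<^sup>2 \<partial>\<^sub>2\<close> and \<open>x\<^sub>1 x\<^sub>2\<^sup>2\<close>.  The other 26 are Jordan chains of the first generator.\<close>

definition adapted_basis :: "((root + nat) \<times> int) list list" where
  "adapted_basis = [
    [(Inl (0,0,0,1), -1), (Inl (0,1,0,0), 1), (Inl (1,0,0,0), -1)],
    [(Inl (-1,-1,-2,0), 1), (Inl (0,-1,-2,-1), 1)], [(Inl (-1,-2,-4,-2), -1)],
    [(Inr 1, -1), (Inr 2, -1), (Inr 4, 1)], [(Inl (-1,-2,-2,0), 1), (Inl (0,-1,-2,-2), 1)],
    [(Inl (-1,-3,-4,-2), -1)], [(Inl (-1,0,0,0), -1), (Inl (0,-1,0,0), 1), (Inl (0,0,0,-1), 1)],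
    [(Inl (-1,-2,-2,-1), 1), (Inl (-1,-1,-2,-2), -1)], [(Inl (-2,-3,-4,-2), 1)],
    [(Inl (0,1,2,2), 1), (Inl (1,1,2,1), 1), (Inl (1,2,2,0), -1)], [(Inr 1, 1), (Inr 2, -1)],
    [(Inl (-1,-2,-2,0), -1), (Inl (-1,-1,-2,-1), -1), (Inl (0,-1,-2,-2), 1)],
    [(Inl (0,1,2,1), -1), (Inl (1,1,2,0), -1)], [(Inl (-1,0,0,0), -1), (Inl (0,-1,0,0), -1)],
    [(Inl (-1,-2,-2,-1), 1), (Inl (-1,-1,-2,-2), 1)], [(Inl (0,1,2,0), 1)], [(Inl (-1,-1,0,0), 1)],
    [(Inl (-1,-2,-2,-2), -1)], [(Inl (0,1,1,1), -1), (Inl (1,1,1,0), 1)],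
    [(Inl (0,-1,-1,0), -1), (Inl (0,0,-1,-1), 1)], [(Inl (-1,-2,-3,-1), 1)],
    [(Inl (0,0,1,1), 1), (Inl (0,1,1,0), 1)], [(Inl (-1,-1,-1,0), 1), (Inl (0,-1,-1,-1), 1)],
    [(Inl (-1,-2,-3,-2), 1)], [(Inl (0,0,1,0), -1)], [(Inl (-1,-1,-1,-1), -1)],
    [(Inl (0,-1,-2,-2), 1)], [(Inl (0,-1,-2,-1), 1)], [(Inl (0,-1,-2,0), -1), (Inl (0,0,0,-1), 1)],
    [(Inr 2, -1), (Inr 3, -1), (Inr 4, -1)], [(Inl (0,0,0,1), -1), (Inl (1,0,0,0), 1)],
    [(Inl (0,1,2,1), -1), (Inl (1,1,0,0), 1), (Inl (1,1,2,0), 1)],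
    [(Inl (0,1,2,2), 1), (Inl (1,2,2,0), -1)], [(Inl (1,1,2,2), 1), (Inl (1,2,2,1), -1)],
    [(Inl (1,2,2,2), -1), (Inl (1,2,4,2), 1)], [(Inl (-1,-1,-1,0), 1)], [(Inl (0,-1,-1,0), 1)],
    [(Inl (0,0,-1,0), 1), (Inl (0,0,1,0), 1)], [(Inl (0,0,1,1), 1), (Inl (0,1,1,0), -1)],
    [(Inl (1,1,1,0), -1)], [(Inl (1,1,1,1), -1)], [(Inl (1,2,3,1), -1)], [(Inl (1,2,3,2), -1)],
    [(Inl (0,-1,-2,0), 1)], [(Inr 2, 1), (Inr 3, 1)],
    [(Inl (0,0,0,1), -1), (Inl (0,1,2,0), 1), (Inl (1,0,0,0), -1)], [(Inl (1,1,0,0), -1)],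
    [(Inl (1,2,2,0), -1)], [(Inl (1,2,2,1), -1)], [(Inl (1,2,2,2), 1)], [(Inl (1,3,4,2), 1)],
    [(Inl (2,3,4,2), 1)]]"

text \<open>Row n of this table and of \<open>act_f\<close> holds the image of the n-th adapted
  vector in adapted coordinates. The first 26 rows refer only to indices below 26. From row 26 on,
  \<open>act_e\<close> is a shift that stops at 34, 42 and 51.\<close>

definition act_e :: "(nat \<times> int) list list" where
  "act_e = [
    [(12, 1)], [(6, 1), (13, 1)], [(7, -1), (14, 1)], [(0, 1), (15, 1)], [(1, 1), (16, 1)],
    [(2, 1), (17, 1)], [(3, -1)], [(4, -1)], [(5, -1)], [], [(15, 1)], [(16, -1)], [(9, 1)],
    [(10, 1)], [(11, 1)], [(12, -1)], [(13, -1)], [(14, -1)], [], [(24, 1)], [(25, -1)], [(18, 1)],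
    [(19, 1)], [(20, 1)], [(21, -1)], [(22, -1)], [(27, 1)], [(28, 1)], [(29, 1)], [(30, 1)],
    [(31, 1)], [(32, 1)], [(33, 1)], [(34, 1)], [], [(36, 1)], [(37, 1)], [(38, 1)], [(39, 1)],
    [(40, 1)], [(41, 1)], [(42, 1)], [], [(44, 1)], [(45, 1)], [(46, 1)], [(47, 1)], [(48, 1)],
    [(49, 1)], [(50, 1)], [(51, 1)], []]"

definition act_f :: "(nat \<times> int) list list" where
  "act_f = [
    [(20, -1)], [], [], [(23, 1)], [], [], [], [], [], [(22, 1)], [], [], [(25, 1)], [], [], [], [],
    [], [(4, 1), (11, 1)], [(5, -1)], [], [(7, 1)], [(8, -1)], [], [(17, -1)], [], [], [], [],
    [(23, -1)], [(20, -1)], [(25, 1)], [(35, 1)], [(19, -1)], [(24, 1), (37, -1)], [(8, -1)],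
    [(5, 1)], [(2, 1), (17, 1)], [(14, 1)], [(26, 1)], [(27, -1)], [(28, -1), (43, -1)],
    [(10, -1), (29, 1), (44, 1)], [], [], [(20, -1)], [], [], [(19, -1), (36, -1)],
    [(24, 1), (37, 1)], [(21, -1), (38, 1)], [(39, -1)]]"

text \<open>The inverse change of basis, a certificate that the adapted vectors span.\<close>

definition inverse_basis :: "((root + nat) \<times> (nat \<times> int) list) list" where
  "inverse_basis = [
    (Inl (-1,-2,-3,-2), [(23, 1)]), (Inl (0,0,0,1), [(15, -1), (30, 1), (45, 1)]),
    (Inl (0,1,0,0), [(0, 1), (15, 1), (45, -1)]), (Inl (0,1,2,0), [(15, 1)]),
    (Inl (1,0,0,0), [(15, -1), (30, -1), (45, 1)]), (Inl (-1,-2,-3,-1), [(20, 1)]),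
    (Inl (0,1,2,1), [(12, 1), (31, 1), (46, 1)]), (Inl (1,1,0,0), [(46, -1)]),
    (Inl (1,1,2,0), [(12, 1), (31, -1), (46, -1)]), (Inl (-1,-1,-1,-1), [(25, -1)]),
    (Inl (0,1,2,2), [(32, 1), (47, -1)]), (Inl (1,1,2,1), [(9, 1), (32, -1)]),
    (Inl (1,2,2,0), [(47, -1)]), (Inl (-1,-1,-1,0), [(35, 1)]),
    (Inl (0,-1,-1,-1), [(22, 1), (35, -1)]), (Inl (1,1,2,2), [(33, 1), (48, -1)]),
    (Inl (1,2,2,1), [(48, -1)]), (Inl (-2,-3,-4,-2), [(8, 1)]), (Inl (0,-1,-1,0), [(36, 1)]),
    (Inl (0,0,-1,-1), [(19, 1), (36, 1)]), (Inl (1,2,2,2), [(49, 1)]),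
    (Inl (1,2,4,2), [(34, 1), (49, 1)]), (Inl (-1,-3,-4,-2), [(5, -1)]),
    (Inl (0,0,-1,0), [(24, 1), (37, 1)]), (Inl (0,0,1,0), [(24, -1)]), (Inl (1,3,4,2), [(50, 1)]),
    (Inl (-1,-2,-4,-2), [(2, -1)]), (Inl (-1,-2,-2,-2), [(17, -1)]),
    (Inl (0,0,1,1), [(21, -1), (38, -1)]), (Inl (0,1,1,0), [(21, -1), (38, 1)]),
    (Inl (2,3,4,2), [(51, 1)]), (Inl (-1,-2,-2,-1), [(7, -1), (14, -1)]),
    (Inl (-1,-1,-2,-2), [(7, 1), (14, -1)]), (Inl (0,1,1,1), [(18, -1), (39, -1)]),
    (Inl (1,1,1,0), [(39, -1)]), (Inl (-1,-2,-2,0), [(4, 1), (26, -1)]),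
    (Inl (-1,-1,-2,-1), [(4, -1), (11, -1), (26, -1)]), (Inl (0,-1,-2,-2), [(26, 1)]),
    (Inl (1,1,1,1), [(40, -1)]), (Inl (-1,-1,-2,0), [(1, 1), (27, -1)]),
    (Inl (-1,-1,0,0), [(16, 1)]), (Inl (0,-1,-2,-1), [(27, 1)]), (Inl (1,2,3,1), [(41, -1)]),
    (Inl (-1,0,0,0), [(6, 1), (13, 1), (28, -1), (43, -1)]), (Inl (0,-1,-2,0), [(43, 1)]),
    (Inl (0,-1,0,0), [(6, -1), (13, 1), (28, 1), (43, 1)]), (Inl (0,0,0,-1), [(28, 1), (43, 1)]),
    (Inl (1,2,3,2), [(42, -1)]), (Inr 1, [(3, 1), (10, -1), (29, 1), (44, 1)]),
    (Inr 2, [(3, 1), (10, 1), (29, 1), (44, 1)]), (Inr 3, [(3, -1), (10, -1), (29, -1)]),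
    (Inr 4, [(29, -1), (44, -1)])]"

text \<open>By positive definiteness, the norm test in \<open>affine_action\<close> detects opposite
  roots.\<close>

lemma root_form_eq_0: "root_form \<alpha> \<alpha> = 0 \<longleftrightarrow> \<alpha> = 0"
proof
  assume "root_form \<alpha> \<alpha> = 0"
  moreover obtain a b c d where \<alpha>: "\<alpha> = (a, b, c, d)" by (cases \<alpha>) auto
  ultimately have "6 * (2 * a - b)\<^sup>2 + 2 * (3 * b - 2 * c)\<^sup>2 + (2 * c - 3 * d)\<^sup>2 + 3 * d\<^sup>2 = 0"
    using root_form_sum_squares[of a b c d] by simp
  moreover have "0 \<le> (2 * a - b)\<^sup>2" "0 \<le> (3 * b - 2 * c)\<^sup>2" "0 \<le> (2 * c - 3 * d)\<^sup>2" "0 \<le> d\<^sup>2"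
    by simp_all
  ultimately have "(2 * a - b)\<^sup>2 = 0" "(3 * b - 2 * c)\<^sup>2 = 0" "(2 * c - 3 * d)\<^sup>2 = 0" "d\<^sup>2 = 0"
    by linarith+
  then show "\<alpha> = 0" by (simp add: \<alpha> zero_prod_def)
qed (simp add: zero_prod_def)

lemma torus_exp_add:
  "\<forall>\<alpha>\<in>set affine_simple. \<forall>\<beta>\<in>roots. \<alpha> + \<beta> \<in> roots \<longrightarrow>
     torus_exp (\<alpha> + \<beta>) = torus_exp \<alpha> + torus_exp \<beta>"
  unfolding mem_roots[of "_ + _"] unfolding roots_eq imp_conv_if by code_simp

text \<open>The bracket of opposite root vectors thus acquires the factor \<open>t ^ 2 = s\<close>,
  which cancels the sign left over in \<open>signs\<close>.\<close>

lemma torus_exp_affine_simple: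
  "\<forall>\<alpha>\<in>set affine_simple. torus_exp \<alpha> + torus_exp (- \<alpha>) = 2"
  by code_simp

lemma act_e_adapted_basis:
  "\<forall>n\<in>set [0..<52]. eq_mod3 (substitute (\<lambda>i. adapted_basis ! i) (act_e ! n))
     (substitute (\<lambda>x. concat (map (\<lambda>\<alpha>. affine_action \<alpha> x) (take 4 affine_simple))) (adapted_basis ! n))"
  by code_simp

lemma act_f_adapted_basis:
  "\<forall>n\<in>set [0..<52]. eq_mod3 (substitute (\<lambda>i. adapted_basis ! i) (act_f ! n))
     (substitute (affine_action (-1,-2,-3,-2)) (adapted_basis ! n))"
  by code_simp

lemma inverse_basis_adapted_basis:
  "\<forall>(x, xs)\<in>set inverse_basis. eq_mod3 [(x, 1)] (substitute (\<lambda>i. adapted_basis ! i) xs)"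
  by code_simp

lemma inverse_basis_complete:
  "map Inl root_list @ map Inr [1, 2, 3, 4] = map fst inverse_basis"
  by code_simp

lemma adapted_basis_indices:
  "\<forall>xs\<in>set adapted_basis. \<forall>(x, _)\<in>set xs. case x of
     Inl \<beta> \<Rightarrow> root_form \<beta> \<beta> = 2 \<or> root_form \<beta> \<beta> = 4 | Inr i \<Rightarrow> 1 \<le> i \<and> i \<le> 4"
  by code_simp

lemma length_tables: "length adapted_basis = 52" "length act_e = 52" "length act_f = 52"
  by (simp_all add: adapted_basis_def act_e_def act_f_def)

lemma inverse_basis_indices: "\<forall>(_, xs)\<in>set inverse_basis. \<forall>(n, _)\<in>set xs. n < 52"
  by code_simp

section \<open>The rescaled basis of the Lie algebra\<close>

locale F4_rescaled = F4_chevalley_basis scale bracket e h N + F4_constants N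
  for scale :: "'k::field \<Rightarrow> 'v::ab_group_add \<Rightarrow> 'v" (infixr \<open>*s\<close> 75)
    and bracket :: "'v \<Rightarrow> 'v \<Rightarrow> 'v"
    and e :: "root \<Rightarrow> 'v" and h :: "nat \<Rightarrow> 'v" and N :: "root \<Rightarrow> root \<Rightarrow> int" +
  fixes c :: "root \<Rightarrow> int" and s :: int and t :: 'k
  assumes char_3: "CHAR('k) = 3"
    and c_unit: "c \<beta> \<in> {1, -1}"
    and s_unit: "s \<in> {1, -1}"
    and c_simple: "\<alpha> \<in> set affine_simple \<Longrightarrow> c \<alpha> = colour \<alpha>"
    and c_opposite: "\<alpha> \<in> set affine_simple \<Longrightarrow> c (- \<alpha>) = colour \<alpha> * s"
    and c_add: "\<lbrakk>\<alpha> \<in> set affine_simple; \<beta> \<in> roots; \<alpha> + \<beta> \<in> roots\<rbrakk> \<Longrightarrow>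
      c (\<alpha> + \<beta>) = c \<beta> * sgn (N \<alpha> \<beta>)"
    and t_square: "t ^ 2 = of_int s"
begin

definition gen :: "root \<Rightarrow> 'v" where
  "gen \<alpha> = t ^ torus_exp \<alpha> *s e \<alpha>"

definition scaled :: "root + nat \<Rightarrow> 'v" where
  "scaled x = (case x of Inl \<beta> \<Rightarrow> (of_int (c \<beta>) * t ^ torus_exp \<beta>) *s e \<beta> | Inr i \<Rightarrow> h i)"

definition adapted :: "nat \<Rightarrow> 'v" where
  "adapted n = combination scaled (adapted_basis ! n)"

lemma units [simp]: "colour \<alpha> * colour \<alpha> = 1" "s * s = 1" "colour \<alpha> * (colour \<alpha> * n) = n"
  using s_unit by (auto simp: colour_def)

text \<open>Along an edge, \<open>c\<close> absorbs the sign of \<open>N\<close> and the exponents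
  of \<open>t\<close> add up, which leaves the absolute value. For opposite roots the factor is
  \<open>colour \<alpha> * s * t ^ 2 = colour \<alpha>\<close>. On \<open>h i\<close> the factor
  \<open>colour \<alpha>\<close> compensates for \<open>c \<alpha>\<close> in the scaled
  vector.\<close>

lemma bracket_gen_scaled:
  assumes \<alpha>: "\<alpha> \<in> set affine_simple" and x: "x \<in> Inl ` roots \<union> Inr ` {1..4}"
  shows "bracket (gen \<alpha>) (scaled x) = combination scaled (affine_action \<alpha> x)"
proof -
  have root: "\<alpha> \<in> roots" using \<alpha> level_affine_simple by blast
  from x consider \<beta> where "x = Inl \<beta>" "\<beta> \<in> roots" | i where "x = Inr i" "i \<in> {1..4}" by blast
  then show ?thesis
  proof cases
    case (1 \<beta>)
    consider "\<alpha> + \<beta> \<in> roots" | "\<alpha> + \<beta> = 0" | "\<alpha> + \<beta> \<notin> roots" "\<alpha> + \<beta> \<noteq> 0" by blast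
    then show ?thesis
    proof cases
      case 1
      have "bracket (gen \<alpha>) (scaled x) = 
          (of_int (c \<beta> * N \<alpha> \<beta>) * t ^ (torus_exp \<alpha> + torus_exp \<beta>)) *s e (\<alpha> + \<beta>)"
        using e_e[OF root \<open>\<beta> \<in> roots\<close> 1] \<open>x = Inl \<beta>\<close>
        by (simp add: gen_def scaled_def bracket_scale_left bracket_scale_right power_add ac_simps)
      also have "c \<beta> * N \<alpha> \<beta> = string_const \<alpha> \<beta> * c (\<alpha> + \<beta>)"
        using c_add[OF \<alpha> \<open>\<beta> \<in> roots\<close> 1] sgn_N(2)[OF root \<open>\<beta> \<in> roots\<close> 1] by (simp add: ac_simps)
      also have "torus_exp \<alpha> + torus_exp \<beta> = torus_exp (\<alpha> + \<beta>)"
        using torus_exp_add \<alpha> \<open>\<beta> \<in> roots\<close> 1 by simp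
      finally show ?thesis
        using 1 \<open>x = Inl \<beta>\<close> by (simp add: affine_action_def mem_roots scaled_def mult.assoc)
    next
      case 2
      then have \<beta>: "\<beta> = - \<alpha>" by (simp add: eq_neg_iff_add_eq_0 add.commute)
      have "bracket (gen \<alpha>) (scaled x) = (of_int (c (- \<alpha>)) * t ^ (torus_exp \<alpha> + torus_exp (- \<alpha>))) *s
          (\<Sum>i\<in>{1..4}. of_int (coroot_coeff \<alpha> i) *s h i)"
        using e_opposite[OF root] \<open>x = Inl \<beta>\<close> \<beta>
        by (simp add: gen_def scaled_def bracket_scale_left bracket_scale_right power_add ac_simps)
      also have "of_int (c (- \<alpha>)) * t ^ (torus_exp \<alpha> + torus_exp (- \<alpha>)) = of_int (colour \<alpha> * (s * s))"
      proof -
        have "torus_exp \<alpha> + torus_exp (- \<alpha>) = 2" using torus_exp_affine_simple \<alpha> by blast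
        then show ?thesis by (simp only: t_square c_opposite[OF \<alpha>] of_int_mult mult.assoc)
      qed
      also have "{1..4::nat} = {1, 2, 3, 4}" by auto
      finally show ?thesis
        using 2 \<open>x = Inl \<beta>\<close> root_form_eq_0[of "\<alpha> + \<beta>"]
        by (simp add: affine_action_def scaled_def scale_right_distrib)
    next
      case 3
      then show ?thesis
        using e_e_0[OF root \<open>\<beta> \<in> roots\<close> 3] \<open>x = Inl \<beta>\<close> root_form_eq_0[of "\<alpha> + \<beta>"]
        by (simp add: affine_action_def mem_roots gen_def scaled_def bracket_scale_left bracket_scale_right Let_def)
    qed
  next
    case (2 i)
    then have "bracket (gen \<alpha>) (scaled x) = - (t ^ torus_exp \<alpha> *s of_int (cartan_integer \<alpha> (simple_root i)) *s e \<alpha>)"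
      using bracket_antisym[of "e \<alpha>" "h i"] h_e[OF 2(2) root]
      by (simp add: gen_def scaled_def bracket_scale_left)
    moreover have "of_int (colour \<alpha>) * of_int (colour \<alpha>) = (1 :: 'k)"
      by (metis units(1) of_int_mult of_int_1)
    ultimately show ?thesis
      using 2 c_simple[OF \<alpha>] by (simp add: affine_action_def scaled_def ac_simps)
  qed
qed

lemma adapted_valid:
  assumes "n < 52" "x \<in> fst ` set (adapted_basis ! n)"
  shows "x \<in> Inl ` roots \<union> Inr ` {1..4}"
proof -
  have "adapted_basis ! n \<in> set adapted_basis" using assms(1) by (simp add: length_tables)
  then show ?thesis
    using adapted_basis_indices assms(2) by (cases x) (fastforce simp: mem_roots)+
qed

lemma combination_adapted: "combination adapted xs = combination scaled (substitute (\<lambda>i. adapted_basis ! i) xs)"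
  unfolding combination_substitute adapted_def ..

lemma bracket_gen_adapted:
  assumes "set as \<subseteq> set affine_simple" "n < 52"
  shows "bracket (\<Sum>\<alpha>\<leftarrow>as. gen \<alpha>) (adapted n) =
    combination scaled (substitute (\<lambda>x. concat (map (\<lambda>\<alpha>. affine_action \<alpha> x) as)) (adapted_basis ! n))"
proof -
  have "bracket (\<Sum>\<alpha>\<leftarrow>as. gen \<alpha>) (scaled x) = combination scaled (concat (map (\<lambda>\<alpha>. affine_action \<alpha> x) as))"
    if "x \<in> Inl ` roots \<union> Inr ` {1..4}" for x
    using assms(1) bracket_gen_scaled[OF _ that]
    by (induction as) (auto simp: bracket_add_left combination_append)
  then show ?thesis
    unfolding adapted_def bracket_combination_right combination_substitute
    using adapted_valid[OF assms(2)] by (intro combination_cong) blast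
qed

lemma bracket_e_adapted:
  assumes "n < 52"
  shows "bracket (\<Sum>\<alpha>\<leftarrow>take 4 affine_simple. gen \<alpha>) (adapted n) = combination adapted (act_e ! n)"
proof -
  have "n \<in> set [0..<52]" using assms by simp
  then show ?thesis
    unfolding bracket_gen_adapted[OF set_take_subset assms] combination_adapted
    by (intro combination_eqI[OF char_3, symmetric]) (rule act_e_adapted_basis[rule_format])
qed

lemma bracket_f_adapted:
  assumes "n < 52"
  shows "bracket (gen (-1,-2,-3,-2)) (adapted n) = combination adapted (act_f ! n)"
proof -
  have "set [(-1,-2,-3,-2)] \<subseteq> set affine_simple" by (simp add: affine_simple_def)
  from bracket_gen_adapted[OF this assms]
  have "bracket (gen (-1,-2,-3,-2)) (adapted n) =
      combination scaled (substitute (affine_action (-1,-2,-3,-2)) (adapted_basis ! n))"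
    by simp
  moreover have "n \<in> set [0..<52]" using assms by simp
  ultimately show ?thesis
    unfolding combination_adapted
    by (simp only:) (intro combination_eqI[OF char_3, symmetric], rule act_f_adapted_basis[rule_format])
qed

lemma scaled_in_span: "scaled x \<in> span (adapted ` {..<52})" if x: "x \<in> Inl ` roots \<union> Inr ` {1..4}"
proof -
  have "x \<in> set (map Inl root_list @ map Inr [1, 2, 3, 4])"
    using x by (auto simp: roots_eq)
  then obtain xs where xs: "(x, xs) \<in> set inverse_basis"
    unfolding inverse_basis_complete by auto
  have "combination scaled [(x, 1)] = combination adapted xs"
    using inverse_basis_adapted_basis xs unfolding combination_adapted
    by (intro combination_eqI[OF char_3]) auto
  also have "\<dots> \<in> span (adapted ` {..<52})"
    using inverse_basis_indices xs by (intro combination_in_subspace) (fastforce intro!: span_base)+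
  finally show ?thesis by simp
qed

lemma t_nonzero: "t \<noteq> 0"
  using t_square s_unit by auto

lemma span_adapted: "span (adapted ` {..<52}) = UNIV"
proof -
  have "e \<beta> \<in> span (adapted ` {..<52})" if "\<beta> \<in> roots" for \<beta>
  proof -
    let ?a = "of_int (c \<beta>) * t ^ torus_exp \<beta>"
    have "?a \<noteq> 0" using c_unit[of \<beta>] t_nonzero by auto
    then have "e \<beta> = inverse ?a *s scaled (Inl \<beta>)"
      unfolding scaled_def sum.case scale_scale by (simp only: left_inverse scale_one not_False_eq_True)
    then show ?thesis using scaled_in_span[of "Inl \<beta>"] that span_scale by auto
  qed
  moreover have "h i \<in> span (adapted ` {..<52})" if "i \<in> {1..4}" for i
    using scaled_in_span[of "Inr i"] that by (simp add: scaled_def)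
  ultimately have "span (e ` roots \<union> h ` {1..4}) \<subseteq> span (adapted ` {..<52})"
    by (intro span_minimal) auto
  then show ?thesis using spanning by blast
qed

text \<open>The dimension is 48 + 4 = 52, so 52 spanning vectors are distinct and
  independent.\<close>

lemma adapted_basis_of_space: "inj_on adapted {..<52}" "independent (adapted ` {..<52})"
proof -
  let ?B = "e ` roots \<union> h ` {1..4}"
  have "card roots = 48"
  proof -
    have "distinct root_list" by code_simp
    then show ?thesis unfolding roots_eq by (simp add: distinct_card) (simp add: root_list_def)
  qed
  moreover have fin: "finite roots" unfolding roots_eq by simp
  moreover have "card (e ` roots) = card roots" "card (h ` {1..4}) = 4"
    using card_image[OF inj_e] card_image[OF inj_h] by simp_all
  ultimately have "card ?B = 52"
    using disjoint by (subst card_Un_disjoint) simp_all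
  interpret finite_dimensional_vector_space scale ?B
    using fin independent spanning by unfold_locales auto
  have dim: "dim UNIV = 52"
    using dim_UNIV \<open>card ?B = 52\<close> by simp
  have "52 \<le> card (adapted ` {..<52})"
    using dim_le_card[of UNIV "adapted ` {..<52}"] span_adapted dim by simp
  then have card: "card (adapted ` {..<52}) = 52"
    using card_image_le[of "{..<52}" adapted] by simp
  then show "inj_on adapted {..<52}"
    by (intro eq_card_imp_inj_on) auto
  show "independent (adapted ` {..<52})"
    using card_le_dim_spanning[of "adapted ` {..<52}" UNIV] span_adapted card dim by auto
qed

lemma gen_eq: "gen \<alpha> = combination scaled [(Inl \<alpha>, colour \<alpha>)]" if "\<alpha> \<in> set affine_simple"
proof -
  have "of_int (colour \<alpha>) * of_int (colour \<alpha>) = (1 :: 'k)"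
    by (metis units(1) of_int_mult of_int_1)
  then show ?thesis
    using c_simple[OF that] by (simp add: gen_def scaled_def mult.assoc[symmetric])
qed

text \<open>Indices 0 and 15 belong to \<open>\<partial>\<^sub>1\<close> and
  \<open>x\<^sub>1\<^sup>2 \<partial>\<^sub>2\<close>, and 23 in \<open>gen_f_eq\<close> to
  \<open>x\<^sub>1 x\<^sub>2\<^sup>2\<close>.\<close>

lemma sum_gen_eq: "(\<Sum>\<alpha>\<leftarrow>take 4 affine_simple. gen \<alpha>) = adapted 0 + adapted 15"
proof -
  have "(\<Sum>\<alpha>\<leftarrow>take 4 affine_simple. gen \<alpha>) =
      combination scaled (map (\<lambda>\<alpha>. (Inl \<alpha>, colour \<alpha>)) (take 4 affine_simple))"
    using gen_eq by (simp add: affine_simple_def)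
  also have "\<dots> = combination adapted [(0, 1), (15, 1)]"
  proof -
    have "eq_mod3 (map (\<lambda>\<alpha>. (Inl \<alpha>, colour \<alpha>)) (take 4 affine_simple))
        (substitute (\<lambda>i. adapted_basis ! i) [(0, 1), (15, 1)])"
      by code_simp
    then show ?thesis unfolding combination_adapted by (rule combination_eqI[OF char_3])
  qed
  finally show ?thesis by simp
qed

lemma gen_f_eq: "gen (-1,-2,-3,-2) = adapted 23"
proof -
  have "(-1,-2,-3,-2) \<in> set affine_simple" "colour (-1,-2,-3,-2) = 1"
    by (simp_all add: affine_simple_def colour_def)
  then have "gen (-1,-2,-3,-2) = combination scaled [(Inl (-1,-2,-3,-2), 1)]"
    using gen_eq by metis
  also have "\<dots> = adapted 23"
    by (simp add: adapted_def adapted_basis_def)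
  finally show ?thesis .
qed

end

section \<open>The subalgebra and its maximality\<close>

context lie_algebra
begin

lemma subalgebra_generated: "subalgebra (generated X)"
  unfolding generated_def
  by (rule hull_in) (auto simp: subalgebra_def intro!: subspace_Inter)

lemma generated_superset: "X \<subseteq> generated X"
  unfolding generated_def by (rule hull_subset)

lemma generated_minimal: "subalgebra S \<Longrightarrow> X \<subseteq> S \<Longrightarrow> generated X \<subseteq> S"
  unfolding generated_def by (simp add: hull_minimal)

lemma subalgebra_stabilizer:
  assumes "subspace S"
  shows "subalgebra {x. \<forall>y\<in>S. bracket x y \<in> S}"
  unfolding subalgebra_def subspace_def
  using assms
  by (auto simp: bracket_add_left bracket_scale_left bracket_bracket
      intro: subspace_0 subspace_add subspace_scale subspace_diff)

text \<open>The stabilizer of S is a subalgebra containing X, hence it contains the generated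
  subalgebra and with it S. So S is closed under the bracket.\<close>

lemma generated_eqI:
  assumes "subspace S" "X \<subseteq> S" "S \<subseteq> generated X"
    and stable: "\<And>x y. x \<in> X \<Longrightarrow> y \<in> S \<Longrightarrow> bracket x y \<in> S"
  shows "generated X = S"
proof
  have "generated X \<subseteq> {x. \<forall>y\<in>S. bracket x y \<in> S}"
    using subalgebra_stabilizer[OF assms(1)] stable by (intro generated_minimal) auto
  then have "subalgebra S" using assms(1,3) by (auto simp: subalgebra_def)
  then show "generated X \<subseteq> S" using assms(2) by (rule generated_minimal)
qed (rule assms(3))

lemma generated_scale:
  assumes "a \<noteq> 0"
  shows "generated {x, a *s y} = generated {x, y}"
proof
  have sub: "subspace (generated X)" for X
    using subalgebra_generated unfolding subalgebra_def by blast
  show "generated {x, a *s y} \<subseteq> generated {x, y}"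
    using generated_superset[of "{x, y}"] subspace_scale[OF sub]
    by (intro generated_minimal subalgebra_generated) auto
  have "inverse a *s a *s y = y" using assms by simp
  then have "y \<in> generated {x, a *s y}"
    using generated_superset[of "{x, a *s y}"] subspace_scale[OF sub, of "a *s y" "{x, a *s y}" "inverse a"]
    by auto
  then show "generated {x, y} \<subseteq> generated {x, a *s y}"
    using generated_superset[of "{x, a *s y}"]
    by (intro generated_minimal subalgebra_generated) auto
qed

lemma bracket_diff_right: "bracket x (y - z) = bracket x y - bracket x z"
  using bracket_add_right[of x y "- z"] by (simp add: bracket_minus_right)

text \<open>An equivalence, like the next ones, so that rewriting drops summands already known to
  lie in the subspace.\<close>

lemma subspace_add_mem_iff:
  "subspace S \<Longrightarrow> x \<in> S \<Longrightarrow> x + y \<in> S \<longleftrightarrow> y \<in> S"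
  using subspace_add subspace_diff[of S "x + y" x] by auto

lemma subspace_add_mem_iff':
  "subspace S \<Longrightarrow> x \<in> S \<Longrightarrow> y + x \<in> S \<longleftrightarrow> y \<in> S"
  using subspace_add_mem_iff[of S x y] by (simp only: add.commute)

lemma subspace_neg_mem_iff: "subspace S \<Longrightarrow> - x \<in> S \<longleftrightarrow> x \<in> S"
  using subspace_neg[of S x] subspace_neg[of S "- x"] by auto

lemma subspace_diff_mem_iff:
  "subspace S \<Longrightarrow> x \<in> S \<Longrightarrow> y - x \<in> S \<longleftrightarrow> y \<in> S"
  using subspace_add_mem_iff'[of S "- x" y] subspace_neg[of S x] by simp

end

lemma act_indices:
  assumes "n < 26"
  shows "\<forall>(m, _)\<in>set (act_e ! n). m < 26" "\<forall>(m, _)\<in>set (act_f ! n). m < 26"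
proof -
  have "\<forall>xs\<in>set (take 26 act_e @ take 26 act_f). \<forall>(m, _)\<in>set xs. m < 26"
    by code_simp
  moreover have "act_e ! n \<in> set (take 26 act_e)" "act_f ! n \<in> set (take 26 act_f)"
    using assms by (auto simp: in_set_conv_nth length_tables intro!: exI[of _ n])
  ultimately show "\<forall>(m, _)\<in>set (act_e ! n). m < 26" "\<forall>(m, _)\<in>set (act_f ! n). m < 26"
    unfolding set_append ball_Un by blast+
qed

text \<open>From here on the root system is replaced by a basis and the matrices of the two
  generators.\<close>

locale adapted_family = lie_algebra scale bracket
  for scale :: "'k::field \<Rightarrow> 'v::ab_group_add \<Rightarrow> 'v" (infixr \<open>*s\<close> 75)
    and bracket :: "'v \<Rightarrow> 'v \<Rightarrow> 'v" +
  fixes v :: "nat \<Rightarrow> 'v"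
  assumes inj_v: "inj_on v {..<52}"
    and independent_v: "independent (v ` {..<52})"
    and span_v: "span (v ` {..<52}) = UNIV"
    and bracket_e: "n < 52 \<Longrightarrow> bracket (v 0 + v 15) (v n) = combination v (act_e ! n)"
    and bracket_f: "n < 52 \<Longrightarrow> bracket (v 23) (v n) = combination v (act_f ! n)"
begin

abbreviation E :: "'v \<Rightarrow> 'v" where "E \<equiv> bracket (v 0 + v 15)"
abbreviation F :: "'v \<Rightarrow> 'v" where "F \<equiv> bracket (v 23)"

definition L :: "'v set" where "L = span (v ` {..<26})"

lemma E_simps [simp]:
  "E (v 0) = v 12" "E (v (Suc 0)) = v 6 + v 13" "E (v 2) = - v 7 + v 14" "E (v 3) = v 0 + v 15"
  "E (v 4) = v 1 + v 16" "E (v 5) = v 2 + v 17" "E (v 6) = - v 3" "E (v 7) = - v 4"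
  "E (v 8) = - v 5" "E (v 9) = 0" "E (v 10) = v 15" "E (v 11) = - v 16" "E (v 12) = v 9"
  "E (v 13) = v 10" "E (v 14) = v 11" "E (v 15) = - v 12" "E (v 16) = - v 13" "E (v 17) = - v 14"
  "E (v 18) = 0" "E (v 19) = v 24" "E (v 20) = - v 25" "E (v 21) = v 18" "E (v 22) = v 19"
  "E (v 23) = v 20" "E (v 24) = - v 21" "E (v 25) = - v 22" "E (v 26) = v 27" "E (v 27) = v 28"
  "E (v 28) = v 29" "E (v 29) = v 30" "E (v 30) = v 31" "E (v 31) = v 32" "E (v 32) = v 33"
  "E (v 33) = v 34" "E (v 34) = 0" "E (v 35) = v 36" "E (v 36) = v 37" "E (v 37) = v 38"
  "E (v 38) = v 39" "E (v 39) = v 40" "E (v 40) = v 41" "E (v 41) = v 42" "E (v 42) = 0"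
  "E (v 43) = v 44" "E (v 44) = v 45" "E (v 45) = v 46" "E (v 46) = v 47" "E (v 47) = v 48"
  "E (v 48) = v 49" "E (v 49) = v 50" "E (v 50) = v 51" "E (v 51) = 0"
  by (simp_all add: bracket_e act_e_def)

lemma F_simps [simp]:
  "F (v 0) = - v 20" "F (v (Suc 0)) = 0" "F (v 2) = 0" "F (v 3) = v 23" "F (v 4) = 0" "F (v 5) = 0"
  "F (v 6) = 0" "F (v 7) = 0" "F (v 8) = 0" "F (v 9) = v 22" "F (v 10) = 0" "F (v 11) = 0"
  "F (v 12) = v 25" "F (v 13) = 0" "F (v 14) = 0" "F (v 15) = 0" "F (v 16) = 0" "F (v 17) = 0"
  "F (v 18) = v 4 + v 11" "F (v 19) = - v 5" "F (v 20) = 0" "F (v 21) = v 7" "F (v 22) = - v 8"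
  "F (v 23) = 0" "F (v 24) = - v 17" "F (v 25) = 0" "F (v 26) = 0" "F (v 27) = 0" "F (v 28) = 0"
  "F (v 29) = - v 23" "F (v 30) = - v 20" "F (v 31) = v 25" "F (v 32) = v 35" "F (v 33) = - v 19"
  "F (v 34) = v 24 - v 37" "F (v 35) = - v 8" "F (v 36) = v 5" "F (v 37) = v 2 + v 17"
  "F (v 38) = v 14" "F (v 39) = v 26" "F (v 40) = - v 27" "F (v 41) = - v 28 - v 43"
  "F (v 42) = - v 10 + v 29 + v 44" "F (v 43) = 0" "F (v 44) = 0" "F (v 45) = - v 20" "F (v 46) = 0"
  "F (v 47) = 0" "F (v 48) = - v 19 - v 36" "F (v 49) = v 24 + v 37" "F (v 50) = - v 21 + v 38"
  "F (v 51) = - v 39"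
  by (simp_all add: bracket_f act_f_def)

lemma v_in_L: "n < 26 \<Longrightarrow> v n \<in> L"
  unfolding L_def by (intro span_base) simp

lemma subspace_L: "subspace L"
  unfolding L_def by (rule subspace_span)

lemma L_stable:
  assumes "x = v 0 + v 15 \<or> x = v 23" "y \<in> L"
  shows "bracket x y \<in> L"
proof -
  have "subspace {y. bracket x y \<in> L}"
    using subspace_L unfolding subspace_def by (simp add: bracket_add_right bracket_scale_right)
  moreover have "bracket x (v n) \<in> L" if "n < 26" for n
  proof -
    have "combination v (act_e ! n) \<in> L" "combination v (act_f ! n) \<in> L"
      using act_indices[OF that] by (intro combination_in_subspace[OF subspace_L] v_in_L; fastforce)+
    then show ?thesis using assms(1) that by (auto simp: bracket_e bracket_f)
  qed
  ultimately show ?thesis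
    using assms(2) span_minimal[of "v ` {..<26}" "{y. bracket x y \<in> L}"] unfolding L_def by blast
qed

lemma generated_eq_L: "generated {v 0 + v 15, v 23} = L"
proof (rule generated_eqI[OF subspace_L])
  let ?G = "generated {v 0 + v 15, v 23}"
  show "{v 0 + v 15, v 23} \<subseteq> L"
    using v_in_L subspace_add[OF subspace_L] by simp
  show "bracket x y \<in> L" if "x \<in> {v 0 + v 15, v 23}" "y \<in> L" for x y
    using L_stable that by blast
  have sub: "subspace ?G" and gens: "v 0 + v 15 \<in> ?G" "v 23 \<in> ?G"
    using subalgebra_generated[of "{v 0 + v 15, v 23}"] generated_superset[of "{v 0 + v 15, v 23}"]
    by (auto simp: subalgebra_def)
  have E: "E x \<in> ?G" and F: "F x \<in> ?G" if "x \<in> ?G" for x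
    using subalgebra_generated[of "{v 0 + v 15, v 23}"] gens that unfolding subalgebra_def by blast+
  note rules = subspace_add_mem_iff[OF sub] subspace_add_mem_iff'[OF sub] subspace_diff_mem_iff[OF sub]
    subspace_neg_mem_iff[OF sub]
  \<comment> \<open>The order is chosen so that every step yields one new vector. Powers of
    \<open>E\<close> give the polynomial part 18 to 25, \<open>F\<close> maps it into the vector
    fields, and \<open>E\<close> with further uses of \<open>F\<close> produces the rest.\<close>
  have 1: "v 20 \<in> ?G" using E[OF gens(2)] by simp
  have 2: "v 25 \<in> ?G" using E[OF 1] by (simp add: rules)
  have 3: "v 22 \<in> ?G" using E[OF 2] by (simp add: rules)
  have 4: "v 19 \<in> ?G" using E[OF 3] by (simp add: rules)
  have 5: "v 24 \<in> ?G" using E[OF 4] by (simp add: rules)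
  have 6: "v 21 \<in> ?G" using E[OF 5] by (simp add: rules)
  have 7: "v 18 \<in> ?G" using E[OF 6] by (simp add: rules)
  have 8: "v 5 \<in> ?G" using F[OF 4] by (simp add: rules)
  have 9: "v 7 \<in> ?G" using F[OF 6] by (simp add: rules)
  have 10: "v 8 \<in> ?G" using F[OF 3] by (simp add: rules)
  have 11: "v 17 \<in> ?G" using F[OF 5] by (simp add: rules)
  have 12: "v 2 \<in> ?G" using E[OF 8] 11 by (simp add: rules)
  have 13: "v 14 \<in> ?G" using E[OF 12] 9 by (simp add: rules)
  have 14: "v 11 \<in> ?G" using E[OF 13] by simp
  have 15: "v 4 \<in> ?G" using F[OF 7] 14 by (simp add: rules)
  have 16: "v 16 \<in> ?G" using E[OF 14] by (simp add: rules)
  have 17: "v 13 \<in> ?G" using E[OF 16] by (simp add: rules)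
  have 18: "v 10 \<in> ?G" using E[OF 17] by simp
  have 19: "v 15 \<in> ?G" using E[OF 18] by simp
  have 20: "v 0 \<in> ?G" using gens(1) 19 by (simp add: rules)
  have 21: "v 12 \<in> ?G" using E[OF 20] by simp
  have 22: "v 9 \<in> ?G" using E[OF 21] by simp
  have 23: "v 1 \<in> ?G" using E[OF 15] 16 by (simp add: rules)
  have 24: "v 6 \<in> ?G" using E[OF 23] 17 by (simp add: rules)
  have 25: "v 3 \<in> ?G" using E[OF 24] by (simp add: rules)
  have "v ` {..<26} \<subseteq> ?G"
    using gens 1 2 3 4 5 6 7 8 9 10 11 12 13 14 15 16 17 18 19 20 21 22 23 24 25
    by (simp add: lessThan_nat_numeral lessThan_Suc)
  then show "L \<subseteq> ?G" unfolding L_def using sub by (rule span_minimal)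
qed

lemma ex_coords: "\<exists>a. x = (\<Sum>n<52. a n *s v n)"
proof -
  have "x \<in> span (v ` {..<52})" by (simp add: span_v)
  then obtain u where "x = (\<Sum>w\<in>v ` {..<52}. u w *s w)"
    using span_finite[of "v ` {..<52}"] by auto
  then have "x = (\<Sum>n<52. u (v n) *s v n)" using inj_v by (simp add: sum.reindex)
  then show ?thesis by (rule exI[of _ "\<lambda>n. u (v n)"])
qed

lemma coords_unique: "(\<Sum>n<52. a n *s v n) = (\<Sum>n<52. b n *s v n) \<Longrightarrow> n < 52 \<Longrightarrow> a n = b n"
proof -
  assume eq: "(\<Sum>n<52. a n *s v n) = (\<Sum>n<52. b n *s v n)" and n: "n < 52"
  let ?i = "inv_into {..<52} v"
  have i: "?i (v m) = m" if "m < 52" for m using inj_v that by (intro inv_into_f_f) auto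
  have "(\<Sum>w\<in>v ` {..<52}. (a (?i w) - b (?i w)) *s w) = (\<Sum>n<52. (a n - b n) *s v n)"
    using i by (subst sum.reindex[OF inj_v]) (auto intro!: sum.cong)
  also have "\<dots> = 0" using eq by (simp add: scale_left_diff_distrib sum_subtractf)
  finally have "a (?i (v n)) - b (?i (v n)) = 0"
    using n by (intro independentD[OF independent_v, where u = "\<lambda>w. a (?i w) - b (?i w)"]) auto
  then show "a n = b n" using i[OF n] by simp
qed

lemma L_eq: "L = {\<Sum>n<26. a n *s v n | a. True}"
proof
  have inj: "inj_on v {..<26}" using inj_v by (rule inj_on_subset) auto
  show "L \<subseteq> {\<Sum>n<26. a n *s v n | a. True}"
  proof
    fix x assume "x \<in> L"
    then obtain u where "x = (\<Sum>w\<in>v ` {..<26}. u w *s w)"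
      unfolding L_def using span_finite[of "v ` {..<26}"] by auto
    then have "x = (\<Sum>n<26. u (v n) *s v n)" using inj by (simp add: sum.reindex)
    then show "x \<in> {\<Sum>n<26. a n *s v n | a. True}"
      by (intro CollectI exI[of _ "\<lambda>n. u (v n)"]) simp
  qed
  show "{\<Sum>n<26. a n *s v n | a. True} \<subseteq> L"
    using v_in_L by (auto intro!: subspace_sum[OF subspace_L] subspace_scale[OF subspace_L])
qed

lemma coords_unique_26:
  assumes "(\<Sum>n<26. a n *s v n) = (\<Sum>n<26. b n *s v n)" "n < 26"
  shows "a n = b n"
proof -
  have extend: "(\<Sum>n<26. f n *s v n) = (\<Sum>n<52. (if n < 26 then f n else 0) *s v n)" for f
    by (rule sum.mono_neutral_cong_left) auto
  have "(if n < 26 then a n else 0) = (if n < 26 then b n else 0)"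
    using assms(1)[unfolded extend] by (rule coords_unique) (use assms(2) in simp)
  then show ?thesis using assms(2) by simp
qed

lemma coords_L:
  assumes "(\<Sum>n<52. a n *s v n) \<in> L" "26 \<le> n" "n < 52"
  shows "a n = 0"
proof -
  obtain b where b: "(\<Sum>n<52. a n *s v n) = (\<Sum>n<26. b n *s v n)"
    using assms(1) unfolding L_eq by blast
  also have "\<dots> = (\<Sum>n<52. (if n < 26 then b n else 0) *s v n)"
    by (rule sum.mono_neutral_cong_left) auto
  finally have "a n = (if n < 26 then b n else 0)" using assms(3) by (rule coords_unique)
  then show ?thesis using assms(2) by simp
qed

lemma L_proper: "L \<noteq> UNIV"
proof
  assume "L = UNIV"
  moreover have "v 51 = (\<Sum>n<52. (if n = 51 then 1 else 0) *s v n)"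
    by (subst sum.mono_neutral_right[where S = "{51}"]) auto
  ultimately show False
    using coords_L[of "\<lambda>n. if n = 51 then 1 else 0" 51] by simp
qed

text \<open>On the complement of \<open>L\<close>, the operator \<open>E\<close> has three Jordan blocks, with bases \<open>v 26, \<dots>, v 34\<close>
  and \<open>v 35, \<dots>, v 42\<close> and \<open>v 43, \<dots>, v 51\<close>.\<close>

lemma E_shift:
  "n \<in> {26..<52} - {34, 42, 51} \<Longrightarrow> E (v n) = v (Suc n)"
proof -
  have "list_all (\<lambda>n. n \<noteq> 34 \<longrightarrow> n \<noteq> 42 \<longrightarrow> n \<noteq> 51 \<longrightarrow> E (v n) = v (Suc n)) [26..<52]" by simp
  then show "n \<in> {26..<52} - {34, 42, 51} \<Longrightarrow> E (v n) = v (Suc n)"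
    unfolding list_all_iff set_upt by auto
qed

text \<open>Modulo \<open>L\<close>, \<open>E\<close> shifts the chain vectors injectively except
  for the three chain ends, which it kills. So only the coordinates at 34, 42 and 51 can
  survive.\<close>

lemma E_kernel_mod_L:
  assumes "E z \<in> L"
  obtains l a b c where "l \<in> L" "z = l + (a *s v 34 + b *s v 42 + c *s v 51)"
proof -
  let ?I = "{26..<52} - {34, 42, 51} :: nat set"
  obtain a where z: "z = (\<Sum>n<52. a n *s v n)" using ex_coords by blast
  have split: "(\<Sum>n<52. f n) = (\<Sum>n<26. f n) + ((\<Sum>n\<in>?I. f n) + (f 34 + f 42 + f 51))"
    for f :: "nat \<Rightarrow> 'v"
  proof -
    have "{..<52} = {..<26} \<union> (?I \<union> {34, 42, 51})" by auto
    also have "sum f \<dots> = (\<Sum>n<26. f n) + (\<Sum>n\<in>?I \<union> {34, 42, 51}. f n)"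
      by (intro sum.union_disjoint) auto
    also have "(\<Sum>n\<in>?I \<union> {34, 42, 51}. f n) = (\<Sum>n\<in>?I. f n) + (\<Sum>n\<in>{34, 42, 51}. f n)"
      by (intro sum.union_disjoint) auto
    also have "(\<Sum>n\<in>{34, 42, 51}. f n) = f 34 + f 42 + f 51"
      by (simp add: add.assoc)
    finally show ?thesis .
  qed
  have low: "(\<Sum>n<26. a n *s v n) \<in> L" unfolding L_eq by blast
  have E_sum: "E (\<Sum>n\<in>A. f n) = (\<Sum>n\<in>A. E (f n))" for A :: "nat set" and f :: "nat \<Rightarrow> 'v"
    by (induction A rule: infinite_finite_induct) (auto simp: bracket_add_right)
  have "E z = E (\<Sum>n<26. a n *s v n) + (\<Sum>n\<in>?I. a n *s v (Suc n))"
    unfolding z split by (simp add: bracket_add_right E_sum bracket_scale_right E_shift)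
  moreover have "E (\<Sum>n<26. a n *s v n) \<in> L" using low L_stable by blast
  ultimately have "(\<Sum>n\<in>?I. a n *s v (Suc n)) \<in> L"
    using assms subspace_add_mem_iff[OF subspace_L] by simp
  moreover have "(\<Sum>n\<in>?I. a n *s v (Suc n)) = (\<Sum>m\<in>Suc ` ?I. a (m - 1) *s v m)"
    by (subst sum.reindex) auto
  moreover have "\<dots> = (\<Sum>m<52. (if m \<in> Suc ` ?I then a (m - 1) else 0) *s v m)"
    by (rule sum.mono_neutral_cong_left) auto
  ultimately have "(\<Sum>m<52. (if m \<in> Suc ` ?I then a (m - 1) else 0) *s v m) \<in> L" by metis
  note high = coords_L[OF this]
  have "a n = 0" if n: "n \<in> ?I" for n
  proof -
    have "26 \<le> Suc n" "Suc n < 52" using n by auto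
    note high[OF this]
    moreover have "Suc n \<in> Suc ` ?I" using n by (rule imageI)
    ultimately show ?thesis by (simp only: if_True diff_Suc_1)
  qed
  then have "z = (\<Sum>n<26. a n *s v n) + (a 34 *s v 34 + a 42 *s v 42 + a 51 *s v 51)"
    unfolding z split by simp
  with low show ?thesis by (rule that)
qed

section \<open>Irreducibility of the quotient by the subalgebra\<close>

lemma E_power_linear:
  "(E ^^ k) (x + y) = (E ^^ k) x + (E ^^ k) y" "(E ^^ k) (a *s x) = a *s (E ^^ k) x" "(E ^^ k) 0 = 0"
  by (induction k) (simp_all add: bracket_add_right bracket_scale_right)

lemma E_power_closed: "(\<And>x. x \<in> S \<Longrightarrow> E x \<in> S) \<Longrightarrow> x \<in> S \<Longrightarrow> (E ^^ k) x \<in> S"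
  by (induction k) auto

text \<open>The three chains have lengths 9, 8 and 9.\<close>

lemma E_nilpotent_mod_L: "(E ^^ 9) x \<in> L"
proof -
  let ?S = "{x. (E ^^ 9) x \<in> L}"
  have "subspace ?S"
    using subspace_L unfolding subspace_def by (simp add: E_power_linear)
  moreover have "v n \<in> ?S" if "n < 52" for n
  proof (cases "n < 26")
    case True
    have "\<And>x. x \<in> L \<Longrightarrow> E x \<in> L" using L_stable by blast
    then show ?thesis using E_power_closed v_in_L[OF True] by blast
  next
    case False
    have pow: "(E ^^ 9) x = E (E (E (E (E (E (E (E (E x))))))))" for x
      by (simp add: eval_nat_numeral)
    have "list_all (\<lambda>n. (E ^^ 9) (v n) = 0) [26..<52]"
      unfolding pow by simp
    then show ?thesis using False that subspace_0[OF subspace_L] unfolding list_all_iff set_upt by auto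
  qed
  ultimately have "span (v ` {..<52}) \<subseteq> ?S" by (intro span_minimal) auto
  then show ?thesis using span_v by blast
qed

lemma maximal_subalgebra_L: "maximal_subalgebra L"
  unfolding maximal_subalgebra_def
proof (intro conjI notI)
  show "subalgebra L" using subalgebra_generated generated_eq_L by metis
  show "L \<subset> UNIV" using L_proper by blast
  assume "\<exists>M. subalgebra M \<and> L \<subset> M \<and> M \<subset> UNIV"
  then obtain M where M: "subalgebra M" "L \<subset> M" "M \<noteq> UNIV" by blast
  then have sub: "subspace M" by (simp add: subalgebra_def)
  have L_M: "x \<in> M" if "x \<in> L" for x using that M by blast
  have v_M: "v n \<in> M" if "n < 26" for n using that L_M v_in_L by blast
  have EM: "E x \<in> M" and FM: "F x \<in> M" if "x \<in> M" for x
    using M(1) that v_M[of 0] v_M[of 15] v_M[of 23] subspace_add[OF sub] unfolding subalgebra_def by auto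
  note rules = subspace_add_mem_iff[OF sub] subspace_add_mem_iff'[OF sub] subspace_diff_mem_iff[OF sub]
    subspace_neg_mem_iff[OF sub]
  have unscale: "x \<in> M" if "a *s x \<in> M" "a \<noteq> 0" for a x
    using subspace_scale[OF sub that(1), of "inverse a"] that(2) by simp
  obtain x where x: "x \<in> M" "x \<notin> L" using M(2) by blast
  \<comment> \<open>The last power of \<open>E\<close> that keeps x outside
    \<open>L\<close>.\<close>
  then obtain k where k: "(E ^^ k) x \<notin> L" "E ((E ^^ k) x) \<in> L"
    using ex_least_nat_less[of "\<lambda>k. (E ^^ k) x \<in> L" 9] E_nilpotent_mod_L[of x] by auto
  obtain l a b c where l: "l \<in> L" "(E ^^ k) x = l + (a *s v 34 + b *s v 42 + c *s v 51)"
    using E_kernel_mod_L[OF k(2)] by blast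
  have "(E ^^ k) x \<in> M" using E_power_closed EM x(1) by blast
  then have w: "a *s v 34 + b *s v 42 + c *s v 51 \<in> M"
    using l L_M subspace_add_mem_iff[OF sub] by simp
  have nonzero: "a \<noteq> 0 \<or> b \<noteq> 0 \<or> c \<noteq> 0" using k(1) l by auto
  have pow7: "(E ^^ 7) x = E (E (E (E (E (E (E x))))))" and pow5: "(E ^^ 5) x = E (E (E (E (E x))))" for x
    by (simp_all add: eval_nat_numeral)
  \<comment> \<open>\<open>F (v 42)\<close> contains \<open>v 44\<close>, which seven shifts move to
    \<open>v 51\<close>. All other terms are killed on the way, so the result is
    \<open>b *s v 51\<close>.\<close>
  have step: "v 51 \<in> M" if w: "a *s v 34 + b *s v 42 + c *s v 51 \<in> M" and b: "b \<noteq> 0" for a b c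
  proof -
    have "(E ^^ 7) (F (a *s v 34 + b *s v 42 + c *s v 51)) \<in> M"
      using E_power_closed EM FM w by blast
    then show ?thesis
      using unscale[OF _ b] v_M
      by (simp add: pow7 bracket_add_right bracket_scale_right bracket_minus_right bracket_diff_right)
  qed
  have "v 51 \<in> M"
  proof (cases "b = 0")
    case False
    then show ?thesis using step w by blast
  next
    case b: True
    show ?thesis
    proof (cases "a = 0")
      case True
      then show ?thesis using w b nonzero unscale by auto
    next
      case False
      \<comment> \<open>With b = 0, \<open>F (v 34)\<close> contributes \<open>- v 37\<close>, which
        five shifts move to \<open>- v 42\<close>; \<open>v 24\<close> and the term from
        \<open>v 51\<close> vanish earlier.\<close>
      have "(E ^^ 5) (F (a *s v 34 + b *s v 42 + c *s v 51)) \<in> M"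
        using E_power_closed EM FM w by blast
      then have "v 42 \<in> M"
        using b unscale[OF _ False] v_M
        by (simp add: pow5 bracket_add_right bracket_scale_right bracket_minus_right bracket_diff_right rules)
      then show ?thesis using step[of 0 1 0] by simp
    qed
  qed
  have shift: "v n \<in> M \<Longrightarrow> v (Suc n) \<in> M" if "n \<in> {26..<52} - {34, 42, 51}" for n
    using EM[of "v n"] E_shift[OF that] by simp
  have chain: "v n \<in> M" if "v m \<in> M" "m \<le> n" "{m..<n} \<subseteq> {26..<52} - {34, 42, 51}" for m n
    using that(2,3,1)
  proof (induction rule: dec_induct)
    case (step n)
    then show ?case using shift[of n] by (auto simp: atLeastLessThanSuc)
  qed
  \<comment> \<open>\<open>F\<close> reaches the head of each chain in turn: 51 to 39 to 26, then 32
    to 35, then 41 to 43. Shifts by \<open>E\<close> fill the chains.\<close>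
  have 39: "v 39 \<in> M" using FM[OF \<open>v 51 \<in> M\<close>] by (simp add: rules)
  have 26: "v 26 \<in> M" using FM[OF 39] by simp
  have U: "v n \<in> M" if "n \<in> {26..34}" for n
    using that by (intro chain[OF 26]) auto
  have 35: "v 35 \<in> M" using FM[OF U[of 32]] by simp
  have V: "v n \<in> M" if "n \<in> {35..42}" for n
    using that by (intro chain[OF 35]) auto
  have 43: "v 43 \<in> M" using FM[OF V[of 41]] U[of 28] subspace_add[OF sub] by (fastforce simp: rules)
  have W: "v n \<in> M" if "n \<in> {43..51}" for n
    using that by (intro chain[OF 43]) auto
  have "v n \<in> M" if "n < 52" for n
  proof -
    have "n < 26 \<or> n \<in> {26..34} \<or> n \<in> {35..42} \<or> n \<in> {43..51}" using that by auto
    then show ?thesis using v_M U V W by blast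
  qed
  then have "span (v ` {..<52}) \<subseteq> M" using sub by (intro span_minimal) auto
  then show False using span_v M(3) by blast
qed

end

section \<open>The Ermolaev algebra\<close>

text \<open>Exponents above 2 give zero, so \<open>mon_mult\<close> holds without side
  conditions.\<close>

lift_definition mon :: "nat \<Rightarrow> nat \<Rightarrow> 'a::comm_ring_1 trunc_poly" is
  "\<lambda>a b i j. if i = a \<and> j = b \<and> a < 3 \<and> b < 3 then 1 else 0"
  by auto

lemma mon_mult: "mon a b * mon c d = (mon (a + c) (b + d) :: 'a::comm_ring_1 trunc_poly)"
proof (rule trunc_poly_eqI)
  fix i j :: nat assume ij: "i < 3" "j < 3"
  let ?y = "\<lambda>k l. tcoeff (mon c d :: 'a trunc_poly) (i - k) (j - l)"
  have "tcoeff (mon a b * mon c d :: 'a trunc_poly) i j =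
      (\<Sum>k\<le>i. \<Sum>l\<le>j. if l = b then if k = a \<and> a < 3 \<and> b < 3 then ?y k l else 0 else 0)"
    unfolding times_trunc_poly.rep_eq using ij
    by (simp del: sum.delta sum.delta') (intro sum.cong refl, auto simp: mon.rep_eq)
  also have "\<dots> = (\<Sum>k\<le>i. if k = a then if b \<le> j \<and> a < 3 \<and> b < 3 then ?y k b else 0 else 0)"
    by (intro sum.cong refl) auto
  also have "\<dots> = tcoeff (mon (a + c) (b + d)) i j"
    using ij by (auto simp: mon.rep_eq)
  finally show "tcoeff (mon a b * mon c d :: 'a trunc_poly) i j = tcoeff (mon (a + c) (b + d)) i j" .
qed

text \<open>For exponent 0 the truncated subtraction is harmless, since the scalar factor
  vanishes.\<close>

lemma partial_mon:
  "a < 3 \<Longrightarrow> partial1 (mon a b) = tscale (of_nat a) (mon (a - 1) b)"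
  "b < 3 \<Longrightarrow> partial2 (mon a b) = tscale (of_nat b) (mon a (b - 1))"
  by (rule trunc_poly_eqI; cases a; cases b;
      auto simp: partial1.rep_eq partial2.rep_eq tscale.rep_eq mon.rep_eq)+

lemma mon_eq_0: "3 \<le> a \<or> 3 \<le> b \<Longrightarrow> mon a b = 0"
  by (rule trunc_poly_eqI) (auto simp: mon.rep_eq zero_trunc_poly.rep_eq)

lemma tscale_zero: "tscale c 0 = 0" "tscale 0 f = 0"
  by (rule trunc_poly_eqI; simp add: tscale.rep_eq zero_trunc_poly.rep_eq)+

lemma tscale_minus: "tscale (- c) f = - tscale c f" "tscale c (- f) = - tscale c f"
  by (rule trunc_poly_eqI; simp add: tscale.rep_eq uminus_trunc_poly.rep_eq)+

lemma partial_zero: "partial1 0 = 0" "partial2 0 = 0"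
  by (rule trunc_poly_eqI; simp add: partial1.rep_eq partial2.rep_eq zero_trunc_poly.rep_eq)+

text \<open>Index \<open>9k + 3i + j\<close> belongs to the monomial \<open>x\<^sub>1\<^sup>i x\<^sub>2\<^sup>j\<close> in the \<open>k\<close>-th component.\<close>

definition er_basis :: "nat \<Rightarrow> 'a::comm_ring_1 ermolaev" where
  "er_basis n = (let m = mon (n mod 9 div 3) (n mod 3) in
     if n div 9 = 0 then ((m, 0), 0) else if n div 9 = 1 then ((0, m), 0) else ((0, 0), m))"

definition er_coeff :: "nat \<Rightarrow> 'a::comm_ring_1 ermolaev \<Rightarrow> 'a" where
  "er_coeff n x = tcoeff (if n div 9 = 0 then fst (fst x) else if n div 9 = 1 then snd (fst x) else snd x)
     (n mod 9 div 3) (n mod 3)"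

lemma er_coeff_add: "er_coeff n (x + y) = er_coeff n x + er_coeff n y"
  by (simp add: er_coeff_def plus_trunc_poly.rep_eq)

lemma er_coeff_zero: "er_coeff n 0 = 0"
  by (simp add: er_coeff_def zero_trunc_poly.rep_eq)

lemma er_coeff_scale: "er_coeff n (er_scale c x) = c * er_coeff n x"
  by (cases "(c, x)" rule: er_scale.cases) (simp add: er_coeff_def tscale.rep_eq)

lemma er_coeff_sum: "er_coeff n (\<Sum>i\<in>I. f i) = (\<Sum>i\<in>I. er_coeff n (f i))"
  by (induction I rule: infinite_finite_induct) (simp_all add: er_coeff_add er_coeff_zero)

lemma er_coeff_basis: "m < 27 \<Longrightarrow> n < 27 \<Longrightarrow> er_coeff m (er_basis n) = (if m = n then 1 else 0)"
proof -
  assume *: "m < 27" "n < 27"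
  \<comment> \<open>The component and the two exponents are digits that determine the index.\<close>
  have "k = 9 * (k div 9) + 3 * (k mod 9 div 3) + k mod 3" for k :: nat
  proof -
    have "k mod 9 mod 3 = k mod 3" by (simp add: mod_mod_cancel)
    then show ?thesis using div_mult_mod_eq[of k 9] div_mult_mod_eq[of "k mod 9" 3] by linarith
  qed
  then have inj: "m = n \<longleftrightarrow> m div 9 = n div 9 \<and> m mod 9 div 3 = n mod 9 div 3 \<and> m mod 3 = n mod 3"
    by metis
  have "m div 9 = 0 \<or> m div 9 = 1 \<or> m div 9 = 2" "n div 9 = 0 \<or> n div 9 = 1 \<or> n div 9 = 2"
    "n mod 9 div 3 < 3" using * by linarith+
  then show ?thesis unfolding inj er_coeff_def er_basis_def Let_def
    by (elim disjE) (simp_all add: mon.rep_eq zero_trunc_poly.rep_eq)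
qed

lemma er_eqI:
  assumes "\<And>n. n < 27 \<Longrightarrow> er_coeff n x = er_coeff n y"
  shows "x = y"
proof -
  have "tcoeff (fst (fst x)) i j = tcoeff (fst (fst y)) i j"
    "tcoeff (snd (fst x)) i j = tcoeff (snd (fst y)) i j" "tcoeff (snd x) i j = tcoeff (snd y) i j"
    if "i < 3" "j < 3" for i j
  proof -
    have "i \<in> {0,1,2}" "j \<in> {0,1,2}" using that by auto
    then show "tcoeff (fst (fst x)) i j = tcoeff (fst (fst y)) i j"
      "tcoeff (snd (fst x)) i j = tcoeff (snd (fst y)) i j" "tcoeff (snd x) i j = tcoeff (snd y) i j"
      using assms[of "3 * i + j"] assms[of "9 + 3 * i + j"] assms[of "18 + 3 * i + j"]
      by (auto simp: er_coeff_def)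
  qed
  then show ?thesis by (intro prod_eqI trunc_poly_eqI)
qed

lemma er_basis_coords: "x = (\<Sum>n<27. er_scale (er_coeff n x) (er_basis n))"
  by (rule er_eqI) (simp add: er_coeff_sum er_coeff_scale er_coeff_basis if_distrib cong: if_cong)

lemma upt_0_26:
  "[0..<26] = [0,1,2,3,4,5,6,7,8,9,10,11,12,13,14,15,16,17,18,19,20,21,22,23,24,25::nat]"
  by code_simp

section \<open>Multiplication in the Ermolaev algebra in characteristic 3\<close>

context
  assumes char: "CHAR('a::field) = 3"
begin

interpretation er: lie_algebra "er_scale :: 'a \<Rightarrow> _" er_bracket
  using char by (rule er_lie_algebra)

text \<open>With \<open>two_eq_minus_one\<close>, this normalises coefficients to 0, 1 and -1, as in
  the tables.\<close>

lemma trunc_double: "x + x = - (x :: 'a trunc_poly)" "- x - x = (x :: 'a trunc_poly)"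
proof -
  have "3 * x = 0" unfolding three_trunc[OF char] by simp
  then show "x + x = - x" "- x - x = x" by (simp_all add: eq_neg_iff_add_eq_0 algebra_simps)
qed

lemma two_eq_minus_one: "(2 :: 'a) = - 1"
  using three[OF char] by (simp add: eq_neg_iff_add_eq_0)

lemmas er_simps = er_basis_def div_act_def mon_mult partial_mon mon_eq_0 tscale_zero tscale_minus
  tscale_simps tscale_mult numeral_2_eq_2[symmetric] partial_zero partial_add partial_diff two_eq_minus_one trunc_double zero_prod_def plus_prod_def minus_prod_def

text \<open>Here and in \<open>er_bracket_e\<close> the tables are those of the adapted vectors,
  which makes the two actions correspond.\<close>

lemma er_bracket_f:
  "list_all (\<lambda>n. er_bracket (er_basis 23) (er_basis n :: 'a ermolaev) =
     er.combination er_basis (act_f ! n)) [0..<26]"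
  unfolding upt_0_26 by (simp add: er_simps act_f_def)

lemma er_bracket_e:
  "list_all (\<lambda>n. er_bracket (er_basis 0 + er_basis 15) (er_basis n :: 'a ermolaev) =
     er.combination er_basis (act_e ! n)) [0..<26]"
  unfolding upt_0_26 by (simp add: er_simps act_e_def)

text \<open>Explicit pairs witnessing that the first 26 basis vectors lie in the derived
  algebra.\<close>

lemma er_basis_brackets:
  "list_all2 (\<lambda>n (i, j). er_bracket (er_basis i) (er_basis j) = (er_basis n :: 'a ermolaev)) [0..<26]
    [(0, 3), (0, 4), (0, 5), (9, 4), (10, 4), (2, 13), (9, 7), (3, 7), (3, 8),
     (0, 12), (0, 13), (0, 14), (9, 13), (3, 13), (3, 14), (9, 16), (6, 13), (10, 17),
     (0, 21), (0, 22), (0, 23), (9, 22), (18, 7), (18, 8), (9, 25), (18, 17)]"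
  unfolding upt_0_26 by (simp add: er_simps)

text \<open>Written as a divergence, the action visibly never produces the top monomial, as the next
  lemma needs.\<close>

lemma div_act_divergence:
  "div_act (f1, f2) g = partial1 (f1 * g) + partial2 (f2 * (g :: 'a trunc_poly))"
  by (simp add: div_act_def partial1_mult[OF char] partial2_mult[OF char] algebra_simps)

lemma er_coeff_26_bracket: "er_coeff 26 (er_bracket x y) = (0 :: 'a)"
proof -
  obtain f1 f2 f g1 g2 g where xy: "x = ((f1, f2), f)" "y = ((g1, g2), g)"
    by (metis surj_pair)
  \<comment> \<open>This coefficient of a partial derivative carries the factor 3.\<close>
  have "tcoeff (partial1 p) 2 2 = 0" "tcoeff (partial2 p) 2 2 = 0" for p :: "'a trunc_poly"
    using three[OF char] by (simp_all add: partial1.rep_eq partial2.rep_eq)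
  then have "tcoeff (div_act (f1, f2) g - div_act (g1, g2) f) 2 2 = 0"
    by (simp add: div_act_divergence minus_trunc_poly.rep_eq plus_trunc_poly.rep_eq)
  then show ?thesis by (simp add: xy er_coeff_def del: One_nat_def)
qed

lemma restricted_ermolaev_eq:
  "restricted_ermolaev = {\<Sum>n<26. er_scale (a n) (er_basis n :: 'a ermolaev) | a. True}"
proof
  let ?K = "{x :: 'a ermolaev. er_coeff 26 x = 0}"
  have "er.subspace ?K"
    unfolding er.subspace_def by (simp add: er_coeff_zero er_coeff_add er_coeff_scale)
  then have "restricted_ermolaev \<subseteq> ?K"
    unfolding restricted_ermolaev_def er.derived_def using er_coeff_26_bracket
    by (intro er.span_minimal) auto
  moreover have "x = (\<Sum>n<26. er_scale (er_coeff n x) (er_basis n))" if "er_coeff 26 x = 0" for x :: "'a ermolaev"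
  proof -
    have "{..<27::nat} = insert 26 {..<26}" by auto
    then show ?thesis using er_basis_coords[of x] that by simp
  qed
  ultimately have "x = (\<Sum>n<26. er_scale (er_coeff n x) (er_basis n))" if "x \<in> restricted_ermolaev"
    for x :: "'a ermolaev"
    using that by blast
  then show "restricted_ermolaev \<subseteq> {\<Sum>n<26. er_scale (a n) (er_basis n :: 'a ermolaev) | a. True}"
    by (intro subsetI CollectI exI conjI TrueI)
  have "er_basis n \<in> er.derived" if n: "n < 26" for n
  proof -
    obtain i j where "er_bracket (er_basis i) (er_basis j) = (er_basis n :: 'a ermolaev)"
      using list_all2_nthD[OF er_basis_brackets, of n] n by (auto simp: case_prod_unfold)
    then show ?thesis
      unfolding er.derived_def by (intro er.span_base CollectI exI conjI TrueI) (rule sym)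
  qed
  then show "{\<Sum>n<26. er_scale (a n) (er_basis n :: 'a ermolaev) | a. True} \<subseteq> restricted_ermolaev"
    unfolding restricted_ermolaev_def er.derived_def
    by (auto intro!: er.span_sum er.span_scale)
qed

lemma er_coords_unique:
  assumes "(\<Sum>n<26. er_scale (a n) (er_basis n :: 'a ermolaev)) = (\<Sum>n<26. er_scale (b n) (er_basis n))" "n < 26"
  shows "a n = b n"
proof -
  have "er_coeff n (\<Sum>n<26. er_scale (c n) (er_basis n :: 'a ermolaev)) = c n" for c
    using assms(2) by (simp add: er_coeff_sum er_coeff_scale er_coeff_basis if_distrib cong: if_cong)
  from this[of a] this[of b] show ?thesis unfolding assms(1) by simp
qed

end

section \<open>Isomorphisms from the action of generators\<close>

locale lie_algebra_pair = A: lie_algebra s1 b1 + B: lie_algebra s2 b2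
  for s1 :: "'k::field \<Rightarrow> 'v::ab_group_add \<Rightarrow> 'v" and b1 :: "'v \<Rightarrow> 'v \<Rightarrow> 'v"
    and s2 :: "'k \<Rightarrow> 'w::ab_group_add \<Rightarrow> 'w" and b2 :: "'w \<Rightarrow> 'w \<Rightarrow> 'w" +
  fixes v :: "nat \<Rightarrow> 'v" and w :: "nat \<Rightarrow> 'w" and d :: nat
  assumes unique1: "(\<Sum>n<d. s1 (a n) (v n)) = (\<Sum>n<d. s1 (b n) (v n)) \<Longrightarrow> n < d \<Longrightarrow> a n = b n"
    and unique2: "(\<Sum>n<d. s2 (a n) (w n)) = (\<Sum>n<d. s2 (b n) (w n)) \<Longrightarrow> n < d \<Longrightarrow> a n = b n"
begin

text \<open>The choice of coordinates is immaterial: by \<open>unique1\<close> it is determined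
  below \<open>d\<close>, and the sum sees nothing else.\<close>

definition transfer :: "'v \<Rightarrow> 'w" where
  "transfer x = (\<Sum>n<d. s2 ((SOME a. x = (\<Sum>n<d. s1 (a n) (v n))) n) (w n))"

definition dom :: "'v set" where
  "dom = {\<Sum>n<d. s1 (a n) (v n) | a. True}"

lemma transfer_sum: "transfer (\<Sum>n<d. s1 (a n) (v n)) = (\<Sum>n<d. s2 (a n) (w n))"
proof -
  let ?b = "SOME b. (\<Sum>n<d. s1 (a n) (v n)) = (\<Sum>n<d. s1 (b n) (v n))"
  have "(\<Sum>n<d. s1 (a n) (v n)) = (\<Sum>n<d. s1 (?b n) (v n))"
    by (rule someI[of "\<lambda>b. (\<Sum>n<d. s1 (a n) (v n)) = (\<Sum>n<d. s1 (b n) (v n))" a]) simp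
  then have "a n = ?b n" if "n < d" for n using unique1 that by blast
  then show ?thesis unfolding transfer_def by (intro sum.cong) auto
qed

lemma dom_add: "x \<in> dom \<Longrightarrow> y \<in> dom \<Longrightarrow> x + y \<in> dom \<and> transfer (x + y) = transfer x + transfer y"
proof -
  assume "x \<in> dom" "y \<in> dom"
  then obtain a b where x: "x = (\<Sum>n<d. s1 (a n) (v n))" and y: "y = (\<Sum>n<d. s1 (b n) (v n))"
    unfolding dom_def by blast
  have "x + y = (\<Sum>n<d. s1 (a n + b n) (v n))"
    unfolding x y by (simp add: A.scale_left_distrib sum.distrib)
  then show ?thesis
    using transfer_sum[of "\<lambda>n. a n + b n"] transfer_sum[of a] transfer_sum[of b]
    unfolding dom_def x y by (auto simp: B.scale_left_distrib sum.distrib)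
qed

lemma dom_scale: "x \<in> dom \<Longrightarrow> s1 c x \<in> dom \<and> transfer (s1 c x) = s2 c (transfer x)"
proof -
  assume "x \<in> dom"
  then obtain a where x: "x = (\<Sum>n<d. s1 (a n) (v n))"
    unfolding dom_def by blast
  have "s1 c x = (\<Sum>n<d. s1 (c * a n) (v n))"
    unfolding x by (simp add: A.scale_sum_right)
  then show ?thesis
    using transfer_sum[of "\<lambda>n. c * a n"] transfer_sum[of a]
    unfolding dom_def x by (auto simp: B.scale_sum_right)
qed

lemma dom_zero: "0 \<in> dom" "transfer 0 = 0"
proof -
  have "(\<Sum>n<d. s1 ((\<lambda>_. 0) n) (v n)) = 0" by simp
  then show "0 \<in> dom" "transfer 0 = 0"
    using transfer_sum[of "\<lambda>_. 0"] unfolding dom_def by (auto intro!: exI[of _ "\<lambda>_. 0"])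
qed

lemma dom_diff: "x \<in> dom \<Longrightarrow> y \<in> dom \<Longrightarrow> x - y \<in> dom \<and> transfer (x - y) = transfer x - transfer y"
  using dom_add[of x "s1 (- 1) y"] dom_scale[of y "- 1"] by simp

lemma dom_v: "n < d \<Longrightarrow> v n \<in> dom \<and> transfer (v n) = w n"
proof -
  assume "n < d"
  then have "(\<Sum>m<d. s1 (if m = n then 1 else 0) (v m)) = v n"
    "(\<Sum>m<d. s2 (if m = n then 1 else 0) (w m)) = w n"
    by (subst sum.mono_neutral_right[where S = "{n}"]; auto)+
  then show ?thesis
    using transfer_sum[of "\<lambda>m. if m = n then 1 else 0"] unfolding dom_def
    by (auto intro!: exI[of _ "\<lambda>m. if m = n then 1 else 0"])
qed

lemma dom_combination:
  "\<forall>(n, _)\<in>set xs. n < d \<Longrightarrow> A.combination v xs \<in> dom \<and> transfer (A.combination v xs) = B.combination w xs"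
proof (induction xs)
  case (Cons x xs)
  then show ?case
    using dom_v[of "fst x"] dom_scale[of "v (fst x)" "of_int (snd x)"]
      dom_add[of "s1 (of_int (snd x)) (v (fst x))" "A.combination v xs"]
    by (cases x) auto
qed (simp add: dom_zero)

lemma transfer_bij: "bij_betw transfer dom {\<Sum>n<d. s2 (a n) (w n) | a. True}"
  unfolding bij_betw_def
proof
  show "inj_on transfer dom"
  proof
    fix x y assume "x \<in> dom" "y \<in> dom" and eq: "transfer x = transfer y"
    then obtain a b where x: "x = (\<Sum>n<d. s1 (a n) (v n))" and y: "y = (\<Sum>n<d. s1 (b n) (v n))"
      unfolding dom_def by blast
    have "a n = b n" if "n < d" for n
      using unique2[OF _ that] eq unfolding x y transfer_sum by blast
    then show "x = y" unfolding x y by (intro sum.cong) auto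
  qed
  show "transfer ` dom = {\<Sum>n<d. s2 (a n) (w n) | a. True}"
    unfolding dom_def using transfer_sum by (auto simp: image_iff) metis+
qed

text \<open>The elements x of \<open>dom\<close> for which \<open>transfer\<close> intertwines the
  brackets with x form a subalgebra, by the Jacobi identity on both sides. It contains the
  generators, hence all of \<open>dom\<close>.\<close>

lemma lie_isomorphic_generated:
  assumes gens: "\<And>xs. xs \<in> X \<Longrightarrow> \<forall>(n, _)\<in>set xs. n < d"
    and action: "\<And>xs n. xs \<in> X \<Longrightarrow> n < d \<Longrightarrow> \<exists>ys. (\<forall>(m, _)\<in>set ys. m < d) \<and>
      b1 (A.combination v xs) (v n) = A.combination v ys \<and>
      b2 (B.combination w xs) (w n) = B.combination w ys"
    and generated: "A.generated (A.combination v ` X) = dom"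
  shows "lie_isomorphic s1 b1 dom s2 b2 {\<Sum>n<d. s2 (a n) (w n) | a. True}"
proof -
  let ?H = "{x \<in> dom. \<forall>y\<in>dom. b1 x y \<in> dom \<and> transfer (b1 x y) = b2 (transfer x) (transfer y)}"
  have "A.subalgebra ?H"
    unfolding A.subalgebra_def A.subspace_def
    by (auto simp: dom_zero dom_add dom_scale dom_diff A.bracket_add_left A.bracket_scale_left
        A.bracket_bracket B.bracket_add_left B.bracket_scale_left B.bracket_bracket)
  moreover have "A.combination v xs \<in> ?H" if xs: "xs \<in> X" for xs
  proof -
    let ?x = "A.combination v xs"
    have "b1 ?x y \<in> dom \<and> transfer (b1 ?x y) = b2 (transfer ?x) (transfer y)" if y_dom: "y \<in> dom" for y
    proof -
      obtain a where y: "y = (\<Sum>n<d. s1 (a n) (v n))" using y_dom unfolding dom_def by blast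
      have step: "b1 ?x (v n) \<in> dom \<and> transfer (b1 ?x (v n)) = b2 (transfer ?x) (transfer (v n))"
        if n: "n < d" for n
        using action[OF xs n] dom_combination gens[OF xs] dom_v[OF n] by metis
      have "m \<le> d \<Longrightarrow> (\<Sum>n<m. s1 (a n) (v n)) \<in> dom \<and> b1 ?x (\<Sum>n<m. s1 (a n) (v n)) \<in> dom \<and>
          transfer (b1 ?x (\<Sum>n<m. s1 (a n) (v n))) = b2 (transfer ?x) (transfer (\<Sum>n<m. s1 (a n) (v n)))" for m
      proof (induction m)
        case (Suc m)
        then show ?case
          using step[of m] dom_v[of m]
          by (simp add: A.bracket_add_right A.bracket_scale_right B.bracket_add_right
              B.bracket_scale_right dom_add dom_scale)
      qed (simp add: dom_zero)
      then show ?thesis using y by blast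
    qed
    then show ?thesis using dom_combination gens[OF xs] by blast
  qed
  ultimately have "dom \<subseteq> ?H"
    unfolding generated[symmetric] by (intro A.generated_minimal) auto
  then show ?thesis
    unfolding lie_isomorphic_def using transfer_bij dom_add dom_scale
    by (intro exI[of _ transfer]) blast
qed

end

theorem theorem1:
  fixes scaleC :: "complex \<Rightarrow> 'c::ab_group_add \<Rightarrow> 'c"
    and bracketC :: "'c \<Rightarrow> 'c \<Rightarrow> 'c"
    and eC :: "root \<Rightarrow> 'c" and hC :: "nat \<Rightarrow> 'c"
    and N :: "root \<Rightarrow> root \<Rightarrow> int"
    and scale :: "'k::alg_closed_field \<Rightarrow> 'v::ab_group_add \<Rightarrow> 'v"
    and bracket :: "'v \<Rightarrow> 'v \<Rightarrow> 'v"
    and e :: "root \<Rightarrow> 'v" and h :: "nat \<Rightarrow> 'v"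
    and L :: "'v set"
  assumes char: "CHAR('k) = 3"
    and complex_basis: "F4_chevalley_basis scaleC bracketC eC hC N"
    and reduction: "F4_chevalley_basis scale bracket e h N"
    and L: "L = lie_algebra.generated scale bracket
      {e (1,0,0,0) + e (0,1,0,0) + e (0,0,0,1) + e (0,1,2,0), e (- (1,2,3,2))}"
  shows "lie_isomorphic scale bracket L er_scale er_bracket restricted_ermolaev \<and>
    lie_algebra.maximal_subalgebra scale bracket L"
proof -
  interpret C: F4_chevalley_basis scaleC bracketC eC hC N by (rule complex_basis)
  interpret G: F4_chevalley_basis scale bracket e h N by (rule reduction)
  have inj: "inj (of_int :: int \<Rightarrow> complex)" by (simp add: inj_def)
  interpret N: F4_constants N by (rule C.F4_constants[OF inj])
  obtain c s where cs: "\<And>\<beta>. c \<beta> \<in> {1, -1}" "s \<in> {1, -1}"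
    "\<And>\<alpha>. \<alpha> \<in> set affine_simple \<Longrightarrow> c \<alpha> = colour \<alpha>"
    "\<And>\<alpha>. \<alpha> \<in> set affine_simple \<Longrightarrow> c (- \<alpha>) = colour \<alpha> * s"
    "\<And>\<alpha> \<beta>. \<lbrakk>\<alpha> \<in> set affine_simple; \<beta> \<in> roots; \<alpha> + \<beta> \<in> roots\<rbrakk> \<Longrightarrow>
      c (\<alpha> + \<beta>) = c \<beta> * sgn (N \<alpha> \<beta>)"
    using N.signs[OF C.N_antisym[OF inj]] by blast
  \<comment> \<open>As \<open>s\<close> may be -1, this uses that the field is algebraically
    closed.\<close>
  obtain t :: 'k where t: "t ^ 2 = of_int s"
    using nth_root_exists[of 2 "of_int s :: 'k"] by auto
  interpret R: F4_rescaled scale bracket e h N c s t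
    by unfold_locales (fact char cs t)+
  interpret A: adapted_family scale bracket R.adapted
    by unfold_locales (fact R.adapted_basis_of_space R.span_adapted
        R.bracket_e_adapted[unfolded R.sum_gen_eq] R.bracket_f_adapted[unfolded R.gen_f_eq])+
  interpret Er: lie_algebra "er_scale :: 'k \<Rightarrow> _" er_bracket
    using char by (rule er_lie_algebra)
  interpret P: lie_algebra_pair scale bracket "er_scale :: 'k \<Rightarrow> _" er_bracket R.adapted er_basis 26
    by unfold_locales (fact A.coords_unique_26 er_coords_unique[OF char])+
  \<comment> \<open>\<open>torus_exp\<close> is 0 on the first four affine simple roots and 1 on the
    last, so only f is rescaled, by t, and the generated subalgebra stays the same.\<close>
  have "(\<Sum>\<alpha>\<leftarrow>take 4 affine_simple. R.gen \<alpha>) = e (1,0,0,0) + e (0,1,0,0) + e (0,0,0,1) + e (0,1,2,0)"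
    by (simp add: affine_simple_def R.gen_def ac_simps)
  moreover have "R.gen (-1,-2,-3,-2) = scale t (e (- (1,2,3,2)))"
    by (simp add: R.gen_def)
  ultimately have L_eq: "L = A.L"
    unfolding L A.generated_eq_L[symmetric] R.sum_gen_eq[symmetric] R.gen_f_eq[symmetric]
    using G.generated_scale[OF R.t_nonzero] by simp
  also have "\<dots> = P.dom"
    unfolding A.L_eq P.dom_def ..
  finally have L_dom: "L = P.dom" .
  have "lie_isomorphic scale bracket P.dom er_scale er_bracket
      {\<Sum>n<26. er_scale (a n) (er_basis n :: 'k ermolaev) | a. True}"
  proof (rule P.lie_isomorphic_generated)
    let ?X = "{[(0, 1), (15, 1)], [(23, 1)]} :: (nat \<times> int) list set"
    show "\<forall>(n, _)\<in>set xs. n < 26" if "xs \<in> ?X" for xs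
      using that by auto
    show "G.generated (G.combination R.adapted ` ?X) = P.dom"
      using A.generated_eq_L L_eq L_dom by simp
    fix xs n assume xs: "xs \<in> ?X" and n: "n < (26::nat)"
    have "er_bracket (er_basis 0 + er_basis 15) (er_basis n :: 'k ermolaev) = Er.combination er_basis (act_e ! n)"
      "er_bracket (er_basis 23) (er_basis n :: 'k ermolaev) = Er.combination er_basis (act_f ! n)"
      using er_bracket_e[OF char] er_bracket_f[OF char] n unfolding list_all_iff set_upt by auto
    then show "\<exists>ys. (\<forall>(m, _)\<in>set ys. m < 26) \<and>
        bracket (G.combination R.adapted xs) (R.adapted n) = G.combination R.adapted ys \<and>
        er_bracket (Er.combination er_basis xs) (er_basis n :: 'k ermolaev) = Er.combination er_basis ys"
      using xs act_indices[OF n] A.bracket_e[of n] A.bracket_f[of n] n by auto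
  qed
  then show ?thesis
    using A.maximal_subalgebra_L unfolding restricted_ermolaev_eq[OF char] L_eq[symmetric] L_dom[symmetric] by blast
qed

end
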